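(* Let $G$ be a finitely generated abelian group and $M$ an abelian group. Then the trace map $$\operatorname{Tr}: H^3_{2\text{-ab}}(G, M) \to \operatorname{Quad}(G, M),\qquad \operatorname{Tr}[(h,c)](x) = c(x,x),$$ is an isomorphism of abelian groups.
   Context: All groups are abelian and written additively. A (standard) 3-cocycle on $G$ with values in $M$ (trivial action) is a function $h:G^3\to M$ with $h(g_1,g_2,g_3) + h(g_1,g_2+g_3,g_4) + h(g_2,g_3,g_4) = h(g_1+g_2,g_3,g_4) + h(g_1,g_2,g_3+g_4)$ for all $g_i\in G$; the group of these is $Z^3(G,M)$. For $k:G^2\to M$ put $(\delta k)(g_1,g_2,g_3)=k(g_2,g_3)-k(g_1+g_2,g_3)+k(g_1,g_2+g_3)-k(g_1,g_2)$. A 2-abelian 3-cocycle is a pair $(h,c)$ with $h\in Z^3(G,M)$ and $c:G^2\to M$ a function such that for all $x,y,z\in G$: $h(y,z,x)+c(x,y+z)+h(x,y,z)=c(x,z)+h(y,x,z)+c(x,y)$ and $-h(z,x,y)+c(x+y,z)-h(x,y,z)=c(x,z)-h(x,z,y)+c(y,z)$. They form an abelian group $Z^3_{2\text{-ab}}(G,M)$ under pointwise addition. The 2-abelian coboundaries $B^3_{2\text{-ab}}(G,M)$ are the pairs $(\delta k, c_k)$, $k:G^2\to M$ any function, $c_k(x,y)=k(y,x)-k(x,y)$. Then $H^3_{2\text{-ab}}(G,M)=Z^3_{2\text{-ab}}(G,M)/B^3_{2\text{-ab}}(G,M)$ (this is a model for $H^4(K(G,2),M)$). A quadratic form $q:G\to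 M$ is a function with $q(-a)=q(a)$ for all $a$ and such that $b_q(a_1,a_2)=q(a_1+a_2)-q(a_1)-q(a_2)$ is bilinear; $\operatorname{Quad}(G,M)$ is the abelian group of all quadratic forms under pointwise addition. For a 2-abelian 3-cocycle $(h,c)$, the function $x\mapsto c(x,x)$ is a quadratic form depending only on the class of $(h,c)$. *)

theory Defs
  imports "HOL-Algebra.Algebra"
begin

text \<open>
  Abelian groups are structures satisfying \<^locale>\<open>comm_group\<close>, hence written multiplicatively: both
  the sums in the group of arguments \<open>G\<close> and those in the group of values \<open>M\<close> appear as \<open>\<otimes>\<close>, and
  minus appears as \<open>inv\<close>. A function \<open>G\<^sup>n \<rightarrow> M\<close> is an element of a \<^const>\<open>product_group\<close> of copies
  of \<open>M\<close> indexed by the carrier of \<open>G\<^sup>n\<close>; it is thus \<^const>\<open>undefined\<close> off that carrier, so that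
  equality of functions is equality on the carrier.
\<close>

definition finitely_generated_group :: "('g, 'a) monoid_scheme \<Rightarrow> bool" where
  "finitely_generated_group G \<longleftrightarrow>
    group G \<and> (\<exists>S. finite S \<and> S \<subseteq> carrier G \<and> generate G S = carrier G)"

definition cochain_group1 ::
    "('g, 'a) monoid_scheme \<Rightarrow> ('m, 'b) monoid_scheme \<Rightarrow> ('g \<Rightarrow> 'm) monoid" where
  "cochain_group1 G M = product_group (carrier G) (\<lambda>_. M)"

definition cochain_group2 ::
    "('g, 'a) monoid_scheme \<Rightarrow> ('m, 'b) monoid_scheme \<Rightarrow> ('g \<times> 'g \<Rightarrow> 'm) monoid" where
  "cochain_group2 G M = product_group (carrier G \<times> carrier G) (\<lambda>_. M)"

definition cochain_group3 ::
    "('g, 'a) monoid_scheme \<Rightarrow> ('m, 'b) monoid_scheme \<Rightarrow> ('g \<times> 'g \<times> 'g \<Rightarrow> 'm) monoid" where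
  "cochain_group3 G M = product_group (carrier G \<times> carrier G \<times> carrier G) (\<lambda>_. M)"

definition cocycles3 ::
    "('g, 'a) monoid_scheme \<Rightarrow> ('m, 'b) monoid_scheme \<Rightarrow> ('g \<times> 'g \<times> 'g \<Rightarrow> 'm) set" where
  "cocycles3 G M = {h \<in> carrier (cochain_group3 G M).
    \<forall>g1\<in>carrier G. \<forall>g2\<in>carrier G. \<forall>g3\<in>carrier G. \<forall>g4\<in>carrier G.
      h (g1, g2, g3) \<otimes>\<^bsub>M\<^esub> h (g1, g2 \<otimes>\<^bsub>G\<^esub> g3, g4) \<otimes>\<^bsub>M\<^esub> h (g2, g3, g4)
      = h (g1 \<otimes>\<^bsub>G\<^esub> g2, g3, g4) \<otimes>\<^bsub>M\<^esub> h (g1, g2, g3 \<otimes>\<^bsub>G\<^esub> g4)}"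

definition coboundary2 ::
    "('g, 'a) monoid_scheme \<Rightarrow> ('m, 'b) monoid_scheme \<Rightarrow> ('g \<times> 'g \<Rightarrow> 'm) \<Rightarrow> 'g \<times> 'g \<times> 'g \<Rightarrow> 'm" where
  "coboundary2 G M k = (\<lambda>(g1, g2, g3) \<in> carrier G \<times> carrier G \<times> carrier G.
      k (g2, g3) \<otimes>\<^bsub>M\<^esub> inv\<^bsub>M\<^esub> k (g1 \<otimes>\<^bsub>G\<^esub> g2, g3)
      \<otimes>\<^bsub>M\<^esub> k (g1, g2 \<otimes>\<^bsub>G\<^esub> g3) \<otimes>\<^bsub>M\<^esub> inv\<^bsub>M\<^esub> k (g1, g2))"

definition commutator2 ::
    "('g, 'a) monoid_scheme \<Rightarrow> ('m, 'b) monoid_scheme \<Rightarrow> ('g \<times> 'g \<Rightarrow> 'm) \<Rightarrow> 'g \<times> 'g \<Rightarrow> 'm" where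
  "commutator2 G M k = (\<lambda>(x, y) \<in> carrier G \<times> carrier G. k (y, x) \<otimes>\<^bsub>M\<^esub> inv\<^bsub>M\<^esub> k (x, y))"

definition two_abelian_cocycles3 ::
    "('g, 'a) monoid_scheme \<Rightarrow> ('m, 'b) monoid_scheme
      \<Rightarrow> (('g \<times> 'g \<times> 'g \<Rightarrow> 'm) \<times> ('g \<times> 'g \<Rightarrow> 'm)) set" where
  "two_abelian_cocycles3 G M = {(h, c). h \<in> cocycles3 G M \<and> c \<in> carrier (cochain_group2 G M) \<and>
    (\<forall>x\<in>carrier G. \<forall>y\<in>carrier G. \<forall>z\<in>carrier G.
      h (y, z, x) \<otimes>\<^bsub>M\<^esub> c (x, y \<otimes>\<^bsub>G\<^esub> z) \<otimes>\<^bsub>M\<^esub> h (x, y, z)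
        = c (x, z) \<otimes>\<^bsub>M\<^esub> h (y, x, z) \<otimes>\<^bsub>M\<^esub> c (x, y) \<and>
      inv\<^bsub>M\<^esub> h (z, x, y) \<otimes>\<^bsub>M\<^esub> c (x \<otimes>\<^bsub>G\<^esub> y, z) \<otimes>\<^bsub>M\<^esub> inv\<^bsub>M\<^esub> h (x, y, z)
        = c (x, z) \<otimes>\<^bsub>M\<^esub> inv\<^bsub>M\<^esub> h (x, z, y) \<otimes>\<^bsub>M\<^esub> c (y, z))}"

definition two_abelian_coboundaries3 ::
    "('g, 'a) monoid_scheme \<Rightarrow> ('m, 'b) monoid_scheme
      \<Rightarrow> (('g \<times> 'g \<times> 'g \<Rightarrow> 'm) \<times> ('g \<times> 'g \<Rightarrow> 'm)) set" where
  "two_abelian_coboundaries3 G M =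
    (\<lambda>k. (coboundary2 G M k, commutator2 G M k)) ` carrier (cochain_group2 G M)"

definition two_abelian_cocycle_group3 ::
    "('g, 'a) monoid_scheme \<Rightarrow> ('m, 'b) monoid_scheme
      \<Rightarrow> (('g \<times> 'g \<times> 'g \<Rightarrow> 'm) \<times> ('g \<times> 'g \<Rightarrow> 'm)) monoid" where
  "two_abelian_cocycle_group3 G M =
    (cochain_group3 G M \<times>\<times> cochain_group2 G M)\<lparr>carrier := two_abelian_cocycles3 G M\<rparr>"

definition two_abelian_cohomology3 ::
    "('g, 'a) monoid_scheme \<Rightarrow> ('m, 'b) monoid_scheme
      \<Rightarrow> (('g \<times> 'g \<times> 'g \<Rightarrow> 'm) \<times> ('g \<times> 'g \<Rightarrow> 'm)) set monoid" where
  "two_abelian_cohomology3 G M = two_abelian_cocycle_group3 G M Mod two_abelian_coboundaries3 G M"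

definition two_abelian_class3 ::
    "('g, 'a) monoid_scheme \<Rightarrow> ('m, 'b) monoid_scheme
      \<Rightarrow> ('g \<times> 'g \<times> 'g \<Rightarrow> 'm) \<times> ('g \<times> 'g \<Rightarrow> 'm)
      \<Rightarrow> (('g \<times> 'g \<times> 'g \<Rightarrow> 'm) \<times> ('g \<times> 'g \<Rightarrow> 'm)) set" where
  "two_abelian_class3 G M hc =
    two_abelian_coboundaries3 G M #>\<^bsub>two_abelian_cocycle_group3 G M\<^esub> hc"

definition polarization ::
    "('g, 'a) monoid_scheme \<Rightarrow> ('m, 'b) monoid_scheme \<Rightarrow> ('g \<Rightarrow> 'm) \<Rightarrow> 'g \<Rightarrow> 'g \<Rightarrow> 'm" where
  "polarization G M q a1 a2 = q (a1 \<otimes>\<^bsub>G\<^esub> a2) \<otimes>\<^bsub>M\<^esub> inv\<^bsub>M\<^esub> q a1 \<otimes>\<^bsub>M\<^esub> inv\<^bsub>M\<^esub> q a2"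

definition bilinear_map ::
    "('g, 'a) monoid_scheme \<Rightarrow> ('m, 'b) monoid_scheme \<Rightarrow> ('g \<Rightarrow> 'g \<Rightarrow> 'm) \<Rightarrow> bool" where
  "bilinear_map G M b \<longleftrightarrow>
    (\<forall>x\<in>carrier G. (\<lambda>y. b x y) \<in> hom G M) \<and> (\<forall>y\<in>carrier G. (\<lambda>x. b x y) \<in> hom G M)"

definition quadratic_forms ::
    "('g, 'a) monoid_scheme \<Rightarrow> ('m, 'b) monoid_scheme \<Rightarrow> ('g \<Rightarrow> 'm) set" where
  "quadratic_forms G M = {q \<in> carrier (cochain_group1 G M).
    (\<forall>a\<in>carrier G. q (inv\<^bsub>G\<^esub> a) = q a) \<and> bilinear_map G M (polarization G M q)}"

definition Quad ::
    "('g, 'a) monoid_scheme \<Rightarrow> ('m, 'b) monoid_scheme \<Rightarrow> ('g \<Rightarrow> 'm) monoid" where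
  "Quad G M = (cochain_group1 G M)\<lparr>carrier := quadratic_forms G M\<rparr>"

definition cocycle_trace ::
    "('g, 'a) monoid_scheme \<Rightarrow> ('g \<times> 'g \<times> 'g \<Rightarrow> 'm) \<times> ('g \<times> 'g \<Rightarrow> 'm) \<Rightarrow> 'g \<Rightarrow> 'm" where
  "cocycle_trace G = (\<lambda>(h, c). \<lambda>x\<in>carrier G. c (x, x))"

text \<open>
  The map induced on classes: the common value of \<^const>\<open>cocycle_trace\<close> on all representatives
  (lemma \<open>trace_map_class\<close> below shows that there is one).
\<close>

definition trace_map ::
    "('g, 'a) monoid_scheme \<Rightarrow> (('g \<times> 'g \<times> 'g \<Rightarrow> 'm) \<times> ('g \<times> 'g \<Rightarrow> 'm)) set \<Rightarrow> 'g \<Rightarrow> 'm" where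
  "trace_map G C = the_elem (cocycle_trace G ` C)"

text \<open>
  The remaining lemmas confirm that these constructions are the intended ones: the cocycles, the
  coboundaries and the quadratic forms are subgroups, so that the factor group is a genuine abelian
  group, and the trace of a class is the trace of any of its representatives.
\<close>

lemma subgroup_imp_comm_group:
  assumes "comm_group A" and "subgroup H A"
  shows "comm_group (A\<lparr>carrier := H\<rparr>)"
proof -
  interpret A: comm_group A by (fact assms(1))
  interpret H: group "A\<lparr>carrier := H\<rparr>" by (rule A.subgroup_imp_group[OF assms(2)])
  show ?thesis
    using subgroup.mem_carrier[OF assms(2)] by (intro H.group_comm_groupI) (auto simp: A.m_comm)
qed

context
  fixes G :: "('g, 'a) monoid_scheme" and M :: "('m, 'b) monoid_scheme"
  assumes G: "comm_group G" and M: "comm_group M"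
begin

interpretation G: comm_group G by (fact G)
interpretation M: comm_group M by (fact M)

lemma comm_group_cochain_group1: "comm_group (cochain_group1 G M)"
  unfolding cochain_group1_def
  by (rule group.group_comm_groupI) (auto simp: PiE_iff M.m_comm intro!: restrict_ext)

lemma comm_group_cochain_group2: "comm_group (cochain_group2 G M)"
  unfolding cochain_group2_def
  by (rule group.group_comm_groupI) (auto simp: PiE_iff M.m_comm intro!: restrict_ext)

lemma comm_group_cochain_group3: "comm_group (cochain_group3 G M)"
  unfolding cochain_group3_def
  by (rule group.group_comm_groupI) (auto simp: PiE_iff M.m_comm intro!: restrict_ext)

lemma comm_group_cochain_pairs: "comm_group (cochain_group3 G M \<times>\<times> cochain_group2 G M)"
proof -
  interpret A: comm_group "cochain_group3 G M" by (rule comm_group_cochain_group3)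
  interpret B: comm_group "cochain_group2 G M" by (rule comm_group_cochain_group2)
  interpret P: group "cochain_group3 G M \<times>\<times> cochain_group2 G M"
    by (intro DirProd_group A.is_group B.is_group)
  show ?thesis
    by (rule P.group_comm_groupI) (auto simp: A.m_comm B.m_comm)
qed

lemma subgroup_quadratic_forms: "subgroup (quadratic_forms G M) (cochain_group1 G M)"
proof -
  interpret A: comm_group "cochain_group1 G M" by (rule comm_group_cochain_group1)
  show ?thesis
  proof (rule A.subgroupI)
    show "quadratic_forms G M \<subseteq> carrier (cochain_group1 G M)"
      by (auto simp: quadratic_forms_def)
    have "(\<lambda>i\<in>carrier G. \<one>\<^bsub>M\<^esub>) \<in> quadratic_forms G M"
      by (auto simp: quadratic_forms_def cochain_group1_def bilinear_map_def polarization_def hom_def)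
    then show "quadratic_forms G M \<noteq> {}" by blast
  next
    fix q assume "q \<in> quadratic_forms G M"
    then have q: "q \<in> (\<Pi>\<^sub>E i\<in>carrier G. carrier M)"
        and s: "\<And>a. a \<in> carrier G \<Longrightarrow> q (inv\<^bsub>G\<^esub> a) = q a"
        and b: "bilinear_map G M (polarization G M q)"
      by (auto simp: quadratic_forms_def cochain_group1_def)
    have qc[simp]: "\<And>a. a \<in> carrier G \<Longrightarrow> q a \<in> carrier M" using q by auto
    have pc: "polarization G M q x y \<in> carrier M" if "x \<in> carrier G" "y \<in> carrier G" for x y
      using that by (simp add: polarization_def)
    have e: "polarization G M (\<lambda>i\<in>carrier G. inv\<^bsub>M\<^esub> q i) x y = inv\<^bsub>M\<^esub> polarization G M q x y"
      if "x \<in> carrier G" "y \<in> carrier G" for x y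
      using that by (simp add: polarization_def M.inv_mult)
    have "bilinear_map G M (polarization G M (\<lambda>i\<in>carrier G. inv\<^bsub>M\<^esub> q i))"
      using b pc by (simp add: bilinear_map_def hom_def Pi_iff e M.inv_mult)
    then show "inv\<^bsub>cochain_group1 G M\<^esub> q \<in> quadratic_forms G M"
      using q s by (auto simp: quadratic_forms_def cochain_group1_def)
  next
    fix q r assume "q \<in> quadratic_forms G M" "r \<in> quadratic_forms G M"
    then have q: "q \<in> (\<Pi>\<^sub>E i\<in>carrier G. carrier M)" "r \<in> (\<Pi>\<^sub>E i\<in>carrier G. carrier M)"
        and s: "\<And>a. a \<in> carrier G \<Longrightarrow> q (inv\<^bsub>G\<^esub> a) = q a" "\<And>a. a \<in> carrier G \<Longrightarrow> r (inv\<^bsub>G\<^esub> a) = r a"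
        and b: "bilinear_map G M (polarization G M q)" "bilinear_map G M (polarization G M r)"
      by (auto simp: quadratic_forms_def cochain_group1_def)
    have qc[simp]: "\<And>a. a \<in> carrier G \<Longrightarrow> q a \<in> carrier M" "\<And>a. a \<in> carrier G \<Longrightarrow> r a \<in> carrier M"
      using q by auto
    have pc: "polarization G M q x y \<in> carrier M" "polarization G M r x y \<in> carrier M"
      if "x \<in> carrier G" "y \<in> carrier G" for x y
      using that by (simp_all add: polarization_def)
    have e: "polarization G M (\<lambda>i\<in>carrier G. q i \<otimes>\<^bsub>M\<^esub> r i) x y
        = polarization G M q x y \<otimes>\<^bsub>M\<^esub> polarization G M r x y"
      if "x \<in> carrier G" "y \<in> carrier G" for x y
      using that by (simp add: polarization_def M.inv_mult M.m_ac)
    have "bilinear_map G M (polarization G M (\<lambda>i\<in>carrier G. q i \<otimes>\<^bsub>M\<^esub> r i))"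
      using b pc by (simp add: bilinear_map_def hom_def Pi_iff e M.m_ac)
    then show "q \<otimes>\<^bsub>cochain_group1 G M\<^esub> r \<in> quadratic_forms G M"
      using q s by (auto simp: quadratic_forms_def cochain_group1_def)
  qed
qed

lemma comm_group_Quad: "comm_group (Quad G M)"
  unfolding Quad_def
  by (intro subgroup_imp_comm_group comm_group_cochain_group1 subgroup_quadratic_forms)

lemma subgroup_two_abelian_cocycles3:
  "subgroup (two_abelian_cocycles3 G M) (cochain_group3 G M \<times>\<times> cochain_group2 G M)"
proof -
  interpret A: comm_group "cochain_group3 G M" by (rule comm_group_cochain_group3)
  interpret B: comm_group "cochain_group2 G M" by (rule comm_group_cochain_group2)
  interpret P: comm_group "cochain_group3 G M \<times>\<times> cochain_group2 G M"
    by (rule comm_group_cochain_pairs)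
  show ?thesis
  proof (rule P.subgroupI)
    show "two_abelian_cocycles3 G M \<subseteq> carrier (cochain_group3 G M \<times>\<times> cochain_group2 G M)"
      by (auto simp: two_abelian_cocycles3_def cocycles3_def)
    have "\<one>\<^bsub>cochain_group3 G M \<times>\<times> cochain_group2 G M\<^esub> \<in> two_abelian_cocycles3 G M"
      by (auto simp: two_abelian_cocycles3_def cocycles3_def cochain_group2_def cochain_group3_def)
    then show "two_abelian_cocycles3 G M \<noteq> {}" by blast
  next
    fix p assume p: "p \<in> two_abelian_cocycles3 G M"
    obtain h c where hc: "p = (h, c)" by fastforce
    have h: "h \<in> (\<Pi>\<^sub>E i\<in>carrier G \<times> carrier G \<times> carrier G. carrier M)"
      and c: "c \<in> (\<Pi>\<^sub>E i\<in>carrier G \<times> carrier G. carrier M)"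
      using p hc by (auto simp: two_abelian_cocycles3_def cocycles3_def cochain_group2_def cochain_group3_def)
    have [simp]: "\<And>x y z. x \<in> carrier G \<Longrightarrow> y \<in> carrier G \<Longrightarrow> z \<in> carrier G \<Longrightarrow> h (x, y, z) \<in> carrier M"
      "\<And>x y. x \<in> carrier G \<Longrightarrow> y \<in> carrier G \<Longrightarrow> c (x, y) \<in> carrier M"
      using h c by auto
    have "inv\<^bsub>cochain_group3 G M \<times>\<times> cochain_group2 G M\<^esub> p
        = ((\<lambda>i\<in>carrier G \<times> carrier G \<times> carrier G. inv\<^bsub>M\<^esub> h i), (\<lambda>i\<in>carrier G \<times> carrier G. inv\<^bsub>M\<^esub> c i))"
      using h c hc A.is_group B.is_group by (simp add: cochain_group2_def cochain_group3_def)
    also have "\<dots> \<in> two_abelian_cocycles3 G M"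
    proof -
      have "h (z, x, y) \<otimes>\<^bsub>M\<^esub> inv\<^bsub>M\<^esub> c (x \<otimes>\<^bsub>G\<^esub> y, z) \<otimes>\<^bsub>M\<^esub> h (x, y, z)
          = inv\<^bsub>M\<^esub> c (x, z) \<otimes>\<^bsub>M\<^esub> h (x, z, y) \<otimes>\<^bsub>M\<^esub> inv\<^bsub>M\<^esub> c (y, z)"
        if x: "x \<in> carrier G" "y \<in> carrier G" "z \<in> carrier G" for x y z
      proof -
        have "inv\<^bsub>M\<^esub> (inv\<^bsub>M\<^esub> h (z, x, y) \<otimes>\<^bsub>M\<^esub> c (x \<otimes>\<^bsub>G\<^esub> y, z) \<otimes>\<^bsub>M\<^esub> inv\<^bsub>M\<^esub> h (x, y, z))
            = inv\<^bsub>M\<^esub> (c (x, z) \<otimes>\<^bsub>M\<^esub> inv\<^bsub>M\<^esub> h (x, z, y) \<otimes>\<^bsub>M\<^esub> c (y, z))"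
          using p hc x by (simp add: two_abelian_cocycles3_def)
        then show ?thesis using x by (simp add: M.inv_mult)
      qed
      then show ?thesis
        using p hc h c
        by (auto simp: two_abelian_cocycles3_def cocycles3_def cochain_group2_def cochain_group3_def
            M.inv_mult [symmetric])
    qed
    finally show "inv\<^bsub>cochain_group3 G M \<times>\<times> cochain_group2 G M\<^esub> p \<in> two_abelian_cocycles3 G M" .
  next
    fix p p' assume p: "p \<in> two_abelian_cocycles3 G M" "p' \<in> two_abelian_cocycles3 G M"
    obtain h c h' c' where hc: "p = (h, c)" "p' = (h', c')" by fastforce
    have h: "h \<in> (\<Pi>\<^sub>E i\<in>carrier G \<times> carrier G \<times> carrier G. carrier M)"
      and c: "c \<in> (\<Pi>\<^sub>E i\<in>carrier G \<times> carrier G. carrier M)"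
      and h': "h' \<in> (\<Pi>\<^sub>E i\<in>carrier G \<times> carrier G \<times> carrier G. carrier M)"
      and c': "c' \<in> (\<Pi>\<^sub>E i\<in>carrier G \<times> carrier G. carrier M)"
      using p hc by (auto simp: two_abelian_cocycles3_def cocycles3_def cochain_group2_def cochain_group3_def)
    have [simp]: "\<And>x y z. x \<in> carrier G \<Longrightarrow> y \<in> carrier G \<Longrightarrow> z \<in> carrier G \<Longrightarrow> h (x, y, z) \<in> carrier M"
      "\<And>x y. x \<in> carrier G \<Longrightarrow> y \<in> carrier G \<Longrightarrow> c (x, y) \<in> carrier M"
      "\<And>x y z. x \<in> carrier G \<Longrightarrow> y \<in> carrier G \<Longrightarrow> z \<in> carrier G \<Longrightarrow> h' (x, y, z) \<in> carrier M"
      "\<And>x y. x \<in> carrier G \<Longrightarrow> y \<in> carrier G \<Longrightarrow> c' (x, y) \<in> carrier M"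
      using h c h' c' by auto
    have i3: "(a \<otimes>\<^bsub>M\<^esub> a') \<otimes>\<^bsub>M\<^esub> (b \<otimes>\<^bsub>M\<^esub> b') \<otimes>\<^bsub>M\<^esub> (d \<otimes>\<^bsub>M\<^esub> d')
        = (a \<otimes>\<^bsub>M\<^esub> b \<otimes>\<^bsub>M\<^esub> d) \<otimes>\<^bsub>M\<^esub> (a' \<otimes>\<^bsub>M\<^esub> b' \<otimes>\<^bsub>M\<^esub> d')"
      if "a \<in> carrier M" "b \<in> carrier M" "d \<in> carrier M" "a' \<in> carrier M" "b' \<in> carrier M" "d' \<in> carrier M"
      for a b d a' b' d'
      using that by (simp add: M.m_ac)
    have i2: "(a \<otimes>\<^bsub>M\<^esub> b) \<otimes>\<^bsub>M\<^esub> (a' \<otimes>\<^bsub>M\<^esub> b') = (a \<otimes>\<^bsub>M\<^esub> a') \<otimes>\<^bsub>M\<^esub> (b \<otimes>\<^bsub>M\<^esub> b')"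
      if "a \<in> carrier M" "b \<in> carrier M" "a' \<in> carrier M" "b' \<in> carrier M" for a b a' b'
      using that by (simp add: M.m_ac)
    have "p \<otimes>\<^bsub>cochain_group3 G M \<times>\<times> cochain_group2 G M\<^esub> p'
        = ((\<lambda>i\<in>carrier G \<times> carrier G \<times> carrier G. h i \<otimes>\<^bsub>M\<^esub> h' i), (\<lambda>i\<in>carrier G \<times> carrier G. c i \<otimes>\<^bsub>M\<^esub> c' i))"
      using hc by (simp add: cochain_group2_def cochain_group3_def)
    also have "\<dots> \<in> two_abelian_cocycles3 G M"
      using p hc h c
      by (auto simp: two_abelian_cocycles3_def cocycles3_def cochain_group2_def cochain_group3_def
          M.inv_mult i3 intro: i2)
    finally show "p \<otimes>\<^bsub>cochain_group3 G M \<times>\<times> cochain_group2 G M\<^esub> p' \<in> two_abelian_cocycles3 G M" .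
  qed
qed

lemma comm_group_two_abelian_cocycle_group3: "comm_group (two_abelian_cocycle_group3 G M)"
  unfolding two_abelian_cocycle_group3_def
  by (intro subgroup_imp_comm_group comm_group_cochain_pairs subgroup_two_abelian_cocycles3)

lemma coboundary2_cocycle_identity:
  assumes "a \<in> carrier M" "b \<in> carrier M" "c \<in> carrier M" "d \<in> carrier M" "e \<in> carrier M" "f \<in> carrier M" "g \<in> carrier M" "h \<in> carrier M" "i \<in> carrier M" "j \<in> carrier M"
  shows "(a \<otimes>\<^bsub>M\<^esub> inv\<^bsub>M\<^esub> b \<otimes>\<^bsub>M\<^esub> c \<otimes>\<^bsub>M\<^esub> inv\<^bsub>M\<^esub> d) \<otimes>\<^bsub>M\<^esub> (e \<otimes>\<^bsub>M\<^esub> inv\<^bsub>M\<^esub> f \<otimes>\<^bsub>M\<^esub> g \<otimes>\<^bsub>M\<^esub> inv\<^bsub>M\<^esub> c) \<otimes>\<^bsub>M\<^esub> (h \<otimes>\<^bsub>M\<^esub> inv\<^bsub>M\<^esub> e \<otimes>\<^bsub>M\<^esub> i \<otimes>\<^bsub>M\<^esub> inv\<^bsub>M\<^esub> a)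
    = (h \<otimes>\<^bsub>M\<^esub> inv\<^bsub>M\<^esub> f \<otimes>\<^bsub>M\<^esub> j \<otimes>\<^bsub>M\<^esub> inv\<^bsub>M\<^esub> b) \<otimes>\<^bsub>M\<^esub> (i \<otimes>\<^bsub>M\<^esub> inv\<^bsub>M\<^esub> j \<otimes>\<^bsub>M\<^esub> g \<otimes>\<^bsub>M\<^esub> inv\<^bsub>M\<^esub> d)"
proof -
  have key: "(a1 \<otimes>\<^bsub>M\<^esub> b2 \<otimes>\<^bsub>M\<^esub> c1 \<otimes>\<^bsub>M\<^esub> d2) \<otimes>\<^bsub>M\<^esub> (e1 \<otimes>\<^bsub>M\<^esub> f2 \<otimes>\<^bsub>M\<^esub> g1 \<otimes>\<^bsub>M\<^esub> c2) \<otimes>\<^bsub>M\<^esub> (h1 \<otimes>\<^bsub>M\<^esub> e2 \<otimes>\<^bsub>M\<^esub> i1 \<otimes>\<^bsub>M\<^esub> a2)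
    = (h1 \<otimes>\<^bsub>M\<^esub> f2 \<otimes>\<^bsub>M\<^esub> j1 \<otimes>\<^bsub>M\<^esub> b2) \<otimes>\<^bsub>M\<^esub> (i1 \<otimes>\<^bsub>M\<^esub> j2 \<otimes>\<^bsub>M\<^esub> g1 \<otimes>\<^bsub>M\<^esub> d2)"
    if [simp]: "a1 \<in> carrier M" "a2 \<in> carrier M" and a: "a1 \<otimes>\<^bsub>M\<^esub> a2 = \<one>\<^bsub>M\<^esub>"
      and [simp]: "b1 \<in> carrier M" "b2 \<in> carrier M" and b: "b1 \<otimes>\<^bsub>M\<^esub> b2 = \<one>\<^bsub>M\<^esub>"
      and [simp]: "c1 \<in> carrier M" "c2 \<in> carrier M" and c: "c1 \<otimes>\<^bsub>M\<^esub> c2 = \<one>\<^bsub>M\<^esub>"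
      and [simp]: "d1 \<in> carrier M" "d2 \<in> carrier M" and d: "d1 \<otimes>\<^bsub>M\<^esub> d2 = \<one>\<^bsub>M\<^esub>"
      and [simp]: "e1 \<in> carrier M" "e2 \<in> carrier M" and e: "e1 \<otimes>\<^bsub>M\<^esub> e2 = \<one>\<^bsub>M\<^esub>"
      and [simp]: "f1 \<in> carrier M" "f2 \<in> carrier M" and f: "f1 \<otimes>\<^bsub>M\<^esub> f2 = \<one>\<^bsub>M\<^esub>"
      and [simp]: "g1 \<in> carrier M" "g2 \<in> carrier M" and g: "g1 \<otimes>\<^bsub>M\<^esub> g2 = \<one>\<^bsub>M\<^esub>"
      and [simp]: "h1 \<in> carrier M" "h2 \<in> carrier M" and h: "h1 \<otimes>\<^bsub>M\<^esub> h2 = \<one>\<^bsub>M\<^esub>"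
      and [simp]: "i1 \<in> carrier M" "i2 \<in> carrier M" and i: "i1 \<otimes>\<^bsub>M\<^esub> i2 = \<one>\<^bsub>M\<^esub>"
      and [simp]: "j1 \<in> carrier M" "j2 \<in> carrier M" and j: "j1 \<otimes>\<^bsub>M\<^esub> j2 = \<one>\<^bsub>M\<^esub>"
    for a1 a2 b1 b2 c1 c2 d1 d2 e1 e2 f1 f2 g1 g2 h1 h2 i1 i2 j1 j2
  proof -
    have cancel: "u \<otimes>\<^bsub>M\<^esub> (v \<otimes>\<^bsub>M\<^esub> w) = w" if "u \<otimes>\<^bsub>M\<^esub> v = \<one>\<^bsub>M\<^esub>" "u \<in> carrier M" "v \<in> carrier M" "w \<in> carrier M" for u v w
      using that by (simp flip: M.m_assoc)
    show ?thesis by (simp add: M.m_ac a b c d e f g h i j cancel[OF a] cancel[OF b] cancel[OF c] cancel[OF d] cancel[OF e] cancel[OF f] cancel[OF g] cancel[OF h] cancel[OF i] cancel[OF j])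
  qed
  show ?thesis
    by (rule key [of a "inv\<^bsub>M\<^esub> a" b "inv\<^bsub>M\<^esub> b" c "inv\<^bsub>M\<^esub> c" d "inv\<^bsub>M\<^esub> d" e "inv\<^bsub>M\<^esub> e" f "inv\<^bsub>M\<^esub> f" g "inv\<^bsub>M\<^esub> g" h "inv\<^bsub>M\<^esub> h" i "inv\<^bsub>M\<^esub> i" j "inv\<^bsub>M\<^esub> j"]) (use assms in simp_all)
qed

lemma coboundary2_first_hexagon_identity:
  assumes "a \<in> carrier M" "b \<in> carrier M" "c \<in> carrier M" "d \<in> carrier M" "e \<in> carrier M" "f \<in> carrier M" "g \<in> carrier M" "h \<in> carrier M" "i \<in> carrier M"
  shows "(a \<otimes>\<^bsub>M\<^esub> inv\<^bsub>M\<^esub> b \<otimes>\<^bsub>M\<^esub> c \<otimes>\<^bsub>M\<^esub> inv\<^bsub>M\<^esub> d) \<otimes>\<^bsub>M\<^esub> (b \<otimes>\<^bsub>M\<^esub> inv\<^bsub>M\<^esub> e) \<otimes>\<^bsub>M\<^esub> (d \<otimes>\<^bsub>M\<^esub> inv\<^bsub>M\<^esub> f \<otimes>\<^bsub>M\<^esub> e \<otimes>\<^bsub>M\<^esub> inv\<^bsub>M\<^esub> g)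
    = (a \<otimes>\<^bsub>M\<^esub> inv\<^bsub>M\<^esub> h) \<otimes>\<^bsub>M\<^esub> (h \<otimes>\<^bsub>M\<^esub> inv\<^bsub>M\<^esub> f \<otimes>\<^bsub>M\<^esub> c \<otimes>\<^bsub>M\<^esub> inv\<^bsub>M\<^esub> i) \<otimes>\<^bsub>M\<^esub> (i \<otimes>\<^bsub>M\<^esub> inv\<^bsub>M\<^esub> g)"
proof -
  have key: "(a1 \<otimes>\<^bsub>M\<^esub> b2 \<otimes>\<^bsub>M\<^esub> c1 \<otimes>\<^bsub>M\<^esub> d2) \<otimes>\<^bsub>M\<^esub> (b1 \<otimes>\<^bsub>M\<^esub> e2) \<otimes>\<^bsub>M\<^esub> (d1 \<otimes>\<^bsub>M\<^esub> f2 \<otimes>\<^bsub>M\<^esub> e1 \<otimes>\<^bsub>M\<^esub> g2)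
    = (a1 \<otimes>\<^bsub>M\<^esub> h2) \<otimes>\<^bsub>M\<^esub> (h1 \<otimes>\<^bsub>M\<^esub> f2 \<otimes>\<^bsub>M\<^esub> c1 \<otimes>\<^bsub>M\<^esub> i2) \<otimes>\<^bsub>M\<^esub> (i1 \<otimes>\<^bsub>M\<^esub> g2)"
    if [simp]: "a1 \<in> carrier M" "a2 \<in> carrier M" and a: "a1 \<otimes>\<^bsub>M\<^esub> a2 = \<one>\<^bsub>M\<^esub>"
      and [simp]: "b1 \<in> carrier M" "b2 \<in> carrier M" and b: "b1 \<otimes>\<^bsub>M\<^esub> b2 = \<one>\<^bsub>M\<^esub>"
      and [simp]: "c1 \<in> carrier M" "c2 \<in> carrier M" and c: "c1 \<otimes>\<^bsub>M\<^esub> c2 = \<one>\<^bsub>M\<^esub>"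
      and [simp]: "d1 \<in> carrier M" "d2 \<in> carrier M" and d: "d1 \<otimes>\<^bsub>M\<^esub> d2 = \<one>\<^bsub>M\<^esub>"
      and [simp]: "e1 \<in> carrier M" "e2 \<in> carrier M" and e: "e1 \<otimes>\<^bsub>M\<^esub> e2 = \<one>\<^bsub>M\<^esub>"
      and [simp]: "f1 \<in> carrier M" "f2 \<in> carrier M" and f: "f1 \<otimes>\<^bsub>M\<^esub> f2 = \<one>\<^bsub>M\<^esub>"
      and [simp]: "g1 \<in> carrier M" "g2 \<in> carrier M" and g: "g1 \<otimes>\<^bsub>M\<^esub> g2 = \<one>\<^bsub>M\<^esub>"
      and [simp]: "h1 \<in> carrier M" "h2 \<in> carrier M" and h: "h1 \<otimes>\<^bsub>M\<^esub> h2 = \<one>\<^bsub>M\<^esub>"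
      and [simp]: "i1 \<in> carrier M" "i2 \<in> carrier M" and i: "i1 \<otimes>\<^bsub>M\<^esub> i2 = \<one>\<^bsub>M\<^esub>"
    for a1 a2 b1 b2 c1 c2 d1 d2 e1 e2 f1 f2 g1 g2 h1 h2 i1 i2
  proof -
    have cancel: "u \<otimes>\<^bsub>M\<^esub> (v \<otimes>\<^bsub>M\<^esub> w) = w" if "u \<otimes>\<^bsub>M\<^esub> v = \<one>\<^bsub>M\<^esub>" "u \<in> carrier M" "v \<in> carrier M" "w \<in> carrier M" for u v w
      using that by (simp flip: M.m_assoc)
    show ?thesis by (simp add: M.m_ac a b c d e f g h i cancel[OF a] cancel[OF b] cancel[OF c] cancel[OF d] cancel[OF e] cancel[OF f] cancel[OF g] cancel[OF h] cancel[OF i])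
  qed
  show ?thesis
    by (rule key [of a "inv\<^bsub>M\<^esub> a" b "inv\<^bsub>M\<^esub> b" c "inv\<^bsub>M\<^esub> c" d "inv\<^bsub>M\<^esub> d" e "inv\<^bsub>M\<^esub> e" f "inv\<^bsub>M\<^esub> f" g "inv\<^bsub>M\<^esub> g" h "inv\<^bsub>M\<^esub> h" i "inv\<^bsub>M\<^esub> i"]) (use assms in simp_all)
qed

lemma coboundary2_second_hexagon_identity:
  assumes "a \<in> carrier M" "b \<in> carrier M" "c \<in> carrier M" "d \<in> carrier M" "e \<in> carrier M" "f \<in> carrier M" "g \<in> carrier M" "h \<in> carrier M" "i \<in> carrier M"
  shows "(inv\<^bsub>M\<^esub> a \<otimes>\<^bsub>M\<^esub> b \<otimes>\<^bsub>M\<^esub> inv\<^bsub>M\<^esub> c \<otimes>\<^bsub>M\<^esub> d) \<otimes>\<^bsub>M\<^esub> (c \<otimes>\<^bsub>M\<^esub> inv\<^bsub>M\<^esub> e) \<otimes>\<^bsub>M\<^esub> (inv\<^bsub>M\<^esub> f \<otimes>\<^bsub>M\<^esub> e \<otimes>\<^bsub>M\<^esub> inv\<^bsub>M\<^esub> g \<otimes>\<^bsub>M\<^esub> a)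
    = (d \<otimes>\<^bsub>M\<^esub> inv\<^bsub>M\<^esub> h) \<otimes>\<^bsub>M\<^esub> (inv\<^bsub>M\<^esub> i \<otimes>\<^bsub>M\<^esub> b \<otimes>\<^bsub>M\<^esub> inv\<^bsub>M\<^esub> g \<otimes>\<^bsub>M\<^esub> h) \<otimes>\<^bsub>M\<^esub> (i \<otimes>\<^bsub>M\<^esub> inv\<^bsub>M\<^esub> f)"
proof -
  have key: "(a2 \<otimes>\<^bsub>M\<^esub> b1 \<otimes>\<^bsub>M\<^esub> c2 \<otimes>\<^bsub>M\<^esub> d1) \<otimes>\<^bsub>M\<^esub> (c1 \<otimes>\<^bsub>M\<^esub> e2) \<otimes>\<^bsub>M\<^esub> (f2 \<otimes>\<^bsub>M\<^esub> e1 \<otimes>\<^bsub>M\<^esub> g2 \<otimes>\<^bsub>M\<^esub> a1)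
    = (d1 \<otimes>\<^bsub>M\<^esub> h2) \<otimes>\<^bsub>M\<^esub> (i2 \<otimes>\<^bsub>M\<^esub> b1 \<otimes>\<^bsub>M\<^esub> g2 \<otimes>\<^bsub>M\<^esub> h1) \<otimes>\<^bsub>M\<^esub> (i1 \<otimes>\<^bsub>M\<^esub> f2)"
    if [simp]: "a1 \<in> carrier M" "a2 \<in> carrier M" and a: "a1 \<otimes>\<^bsub>M\<^esub> a2 = \<one>\<^bsub>M\<^esub>"
      and [simp]: "b1 \<in> carrier M" "b2 \<in> carrier M" and b: "b1 \<otimes>\<^bsub>M\<^esub> b2 = \<one>\<^bsub>M\<^esub>"
      and [simp]: "c1 \<in> carrier M" "c2 \<in> carrier M" and c: "c1 \<otimes>\<^bsub>M\<^esub> c2 = \<one>\<^bsub>M\<^esub>"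
      and [simp]: "d1 \<in> carrier M" "d2 \<in> carrier M" and d: "d1 \<otimes>\<^bsub>M\<^esub> d2 = \<one>\<^bsub>M\<^esub>"
      and [simp]: "e1 \<in> carrier M" "e2 \<in> carrier M" and e: "e1 \<otimes>\<^bsub>M\<^esub> e2 = \<one>\<^bsub>M\<^esub>"
      and [simp]: "f1 \<in> carrier M" "f2 \<in> carrier M" and f: "f1 \<otimes>\<^bsub>M\<^esub> f2 = \<one>\<^bsub>M\<^esub>"
      and [simp]: "g1 \<in> carrier M" "g2 \<in> carrier M" and g: "g1 \<otimes>\<^bsub>M\<^esub> g2 = \<one>\<^bsub>M\<^esub>"
      and [simp]: "h1 \<in> carrier M" "h2 \<in> carrier M" and h: "h1 \<otimes>\<^bsub>M\<^esub> h2 = \<one>\<^bsub>M\<^esub>"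
      and [simp]: "i1 \<in> carrier M" "i2 \<in> carrier M" and i: "i1 \<otimes>\<^bsub>M\<^esub> i2 = \<one>\<^bsub>M\<^esub>"
    for a1 a2 b1 b2 c1 c2 d1 d2 e1 e2 f1 f2 g1 g2 h1 h2 i1 i2
  proof -
    have cancel: "u \<otimes>\<^bsub>M\<^esub> (v \<otimes>\<^bsub>M\<^esub> w) = w" if "u \<otimes>\<^bsub>M\<^esub> v = \<one>\<^bsub>M\<^esub>" "u \<in> carrier M" "v \<in> carrier M" "w \<in> carrier M" for u v w
      using that by (simp flip: M.m_assoc)
    show ?thesis by (simp add: M.m_ac a b c d e f g h i cancel[OF a] cancel[OF b] cancel[OF c] cancel[OF d] cancel[OF e] cancel[OF f] cancel[OF g] cancel[OF h] cancel[OF i])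
  qed
  show ?thesis
    by (rule key [of a "inv\<^bsub>M\<^esub> a" b "inv\<^bsub>M\<^esub> b" c "inv\<^bsub>M\<^esub> c" d "inv\<^bsub>M\<^esub> d" e "inv\<^bsub>M\<^esub> e" f "inv\<^bsub>M\<^esub> f" g "inv\<^bsub>M\<^esub> g" h "inv\<^bsub>M\<^esub> h" i "inv\<^bsub>M\<^esub> i"]) (use assms in simp_all)
qed

lemma two_abelian_coboundaries3_subset: "two_abelian_coboundaries3 G M \<subseteq> two_abelian_cocycles3 G M"
proof
  fix p assume "p \<in> two_abelian_coboundaries3 G M"
  then obtain k where k: "k \<in> (\<Pi>\<^sub>E i\<in>carrier G \<times> carrier G. carrier M)"
    and p: "p = (coboundary2 G M k, commutator2 G M k)"
    by (auto simp: two_abelian_coboundaries3_def cochain_group2_def)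
  have kc[simp]: "k (x, y) \<in> carrier M" if "x \<in> carrier G" "y \<in> carrier G" for x y
    using k that by auto
  have "coboundary2 G M k \<in> cocycles3 G M"
    unfolding cocycles3_def
    by (auto simp: cochain_group3_def coboundary2_def G.m_assoc intro!: coboundary2_cocycle_identity)
  moreover have "commutator2 G M k \<in> carrier (cochain_group2 G M)"
    by (auto simp: cochain_group2_def commutator2_def)
  moreover have "coboundary2 G M k (y, z, x) \<otimes>\<^bsub>M\<^esub> commutator2 G M k (x, y \<otimes>\<^bsub>G\<^esub> z) \<otimes>\<^bsub>M\<^esub> coboundary2 G M k (x, y, z)
        = commutator2 G M k (x, z) \<otimes>\<^bsub>M\<^esub> coboundary2 G M k (y, x, z) \<otimes>\<^bsub>M\<^esub> commutator2 G M k (x, y)"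
    if "x \<in> carrier G" "y \<in> carrier G" "z \<in> carrier G" for x y z
    using that G.m_comm[of x y] G.m_comm[of x z]
      coboundary2_first_hexagon_identity[of "k (z, x)" "k (y \<otimes>\<^bsub>G\<^esub> z, x)" "k (y, z \<otimes>\<^bsub>G\<^esub> x)" "k (y, z)"
        "k (x, y \<otimes>\<^bsub>G\<^esub> z)" "k (x \<otimes>\<^bsub>G\<^esub> y, z)" "k (x, y)" "k (x, z)" "k (y, x)"]
    by (simp add: coboundary2_def commutator2_def)
  moreover have "inv\<^bsub>M\<^esub> coboundary2 G M k (z, x, y) \<otimes>\<^bsub>M\<^esub> commutator2 G M k (x \<otimes>\<^bsub>G\<^esub> y, z)
          \<otimes>\<^bsub>M\<^esub> inv\<^bsub>M\<^esub> coboundary2 G M k (x, y, z)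
        = commutator2 G M k (x, z) \<otimes>\<^bsub>M\<^esub> inv\<^bsub>M\<^esub> coboundary2 G M k (x, z, y) \<otimes>\<^bsub>M\<^esub> commutator2 G M k (y, z)"
    if "x \<in> carrier G" "y \<in> carrier G" "z \<in> carrier G" for x y z
    using that G.m_comm[of x z] G.m_comm[of y z]
      coboundary2_second_hexagon_identity[of "k (x, y)" "k (z \<otimes>\<^bsub>G\<^esub> x, y)" "k (z, x \<otimes>\<^bsub>G\<^esub> y)" "k (z, x)"
        "k (x \<otimes>\<^bsub>G\<^esub> y, z)" "k (y, z)" "k (x, y \<otimes>\<^bsub>G\<^esub> z)" "k (x, z)" "k (z, y)"]
    by (simp add: coboundary2_def commutator2_def M.inv_mult)
  ultimately show "p \<in> two_abelian_cocycles3 G M"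
    by (simp add: p two_abelian_cocycles3_def)
qed

lemma subgroup_two_abelian_coboundaries3:
  "subgroup (two_abelian_coboundaries3 G M) (two_abelian_cocycle_group3 G M)"
proof -
  interpret B: comm_group "cochain_group2 G M" by (rule comm_group_cochain_group2)
  interpret P: comm_group "cochain_group3 G M \<times>\<times> cochain_group2 G M"
    by (rule comm_group_cochain_pairs)
  have "group_hom (cochain_group2 G M) (cochain_group3 G M \<times>\<times> cochain_group2 G M)
      (\<lambda>k. (coboundary2 G M k, commutator2 G M k))"
  proof (unfold_locales, rule homI)
    fix k assume "k \<in> carrier (cochain_group2 G M)"
    then show "(coboundary2 G M k, commutator2 G M k) \<in> carrier (cochain_group3 G M \<times>\<times> cochain_group2 G M)"
      using two_abelian_coboundaries3_subset
      by (auto simp: two_abelian_coboundaries3_def two_abelian_cocycles3_def cocycles3_def)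
  next
    fix k l assume "k \<in> carrier (cochain_group2 G M)" "l \<in> carrier (cochain_group2 G M)"
    then have kl: "k \<in> (\<Pi>\<^sub>E i\<in>carrier G \<times> carrier G. carrier M)"
        "l \<in> (\<Pi>\<^sub>E i\<in>carrier G \<times> carrier G. carrier M)"
      by (auto simp: cochain_group2_def)
    have [simp]: "k (x, y) \<in> carrier M" "l (x, y) \<in> carrier M" if "x \<in> carrier G" "y \<in> carrier G" for x y
      using kl that by auto
    show "(coboundary2 G M (k \<otimes>\<^bsub>cochain_group2 G M\<^esub> l), commutator2 G M (k \<otimes>\<^bsub>cochain_group2 G M\<^esub> l))
      = (coboundary2 G M k, commutator2 G M k)
        \<otimes>\<^bsub>cochain_group3 G M \<times>\<times> cochain_group2 G M\<^esub> (coboundary2 G M l, commutator2 G M l)"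
      by (auto simp: cochain_group2_def cochain_group3_def coboundary2_def commutator2_def
          M.inv_mult M.m_ac fun_eq_iff restrict_def)
  qed
  then have "subgroup (two_abelian_coboundaries3 G M) (cochain_group3 G M \<times>\<times> cochain_group2 G M)"
    unfolding two_abelian_coboundaries3_def by (rule group_hom.img_is_subgroup)
  then show ?thesis
    unfolding two_abelian_cocycle_group3_def
    by (rule P.subgroup_incl [OF _ subgroup_two_abelian_cocycles3 two_abelian_coboundaries3_subset])
qed

lemma comm_group_two_abelian_cohomology3: "comm_group (two_abelian_cohomology3 G M)"
  unfolding two_abelian_cohomology3_def
  by (intro comm_group.abelian_FactGroup comm_group_two_abelian_cocycle_group3
      subgroup_two_abelian_coboundaries3)

lemma trace_map_class:
  assumes hc: "(h, c) \<in> two_abelian_cocycles3 G M"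
  shows "trace_map G (two_abelian_class3 G M (h, c)) = (\<lambda>x\<in>carrier G. c (x, x))"
proof -
  interpret Z: comm_group "two_abelian_cocycle_group3 G M" by (rule comm_group_two_abelian_cocycle_group3)
  have c: "c (x, x) \<in> carrier M" if "x \<in> carrier G" for x
    using hc that by (auto simp: two_abelian_cocycles3_def cochain_group2_def)
  have "(h, c) \<in> two_abelian_class3 G M (h, c)"
    unfolding two_abelian_class3_def
    by (rule Z.rcos_self [OF _ subgroup_two_abelian_coboundaries3])
      (use hc in \<open>simp add: two_abelian_cocycle_group3_def\<close>)
  moreover have "cocycle_trace G p = (\<lambda>x\<in>carrier G. c (x, x))"
    if mem: "p \<in> two_abelian_class3 G M (h, c)" for p
  proof -
    obtain b where b: "b \<in> two_abelian_coboundaries3 G M"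
      and pb: "p = b \<otimes>\<^bsub>two_abelian_cocycle_group3 G M\<^esub> (h, c)"
      using mem unfolding two_abelian_class3_def r_coset_def by blast
    obtain k where k: "k \<in> (\<Pi>\<^sub>E i\<in>carrier G \<times> carrier G. carrier M)"
      and bk: "b = (coboundary2 G M k, commutator2 G M k)"
      using b by (auto simp: two_abelian_coboundaries3_def cochain_group2_def)
    note p = pb [unfolded bk]
    have "k (x, x) \<in> carrier M" if "x \<in> carrier G" for x
      using k that by auto
    with c show ?thesis
      by (auto simp: p cocycle_trace_def two_abelian_cocycle_group3_def DirProd_def cochain_group2_def
          commutator2_def intro!: restrict_ext)
  qed
  ultimately have "cocycle_trace G ` two_abelian_class3 G M (h, c) = {\<lambda>x\<in>carrier G. c (x, x)}"
    by (metis (no_types, lifting) image_cong image_constant)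
  then show ?thesis
    by (simp add: trace_map_def)
qed

end

end

theory Submission
  imports Defs
begin

text \<open>
  The trace is a homomorphism from cocycles to quadratic forms, with the coboundaries in its kernel,
  so everything rests on two facts: a cocycle of trace zero is a coboundary, and every quadratic form
  is a trace. Both are proved by induction along a decomposition of the group into cyclic summands.

  For a cyclic group generated by \<open>a\<close> a coboundary achieves \<open>h(a, x, y) = 0\<close> except for
  \<open>x = -a\<close>; the hexagons and \<open>c(a, a) = 0\<close> then force \<open>h = 0\<close> and \<open>c = 0\<close>. Conversely
  \<open>c(ia, ja) = ij q(a)\<close> for reduced representatives, where \<open>h\<close> compensates the carries.

  For \<open>A \<oplus> D\<close> and a cocycle of trace zero, \<open>c\<close> is antisymmetric, so subtracting
  the coboundary of the interchange \<open>(a + b) + (a' + b') \<rightarrow> (a + a') + (b + b')\<close> leaves only the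
  cocycles on \<open>A\<close> and \<open>D\<close>. Conversely the traces on \<open>A\<close> and \<open>D\<close> are combined by adding the bilinear
  cocycle \<open>(0, b\<^sub>q(a, b'))\<close>.
\<close>

context comm_group
begin

lemma l_inv_left: "x \<in> carrier G \<Longrightarrow> y \<in> carrier G \<Longrightarrow> inv x \<otimes> (x \<otimes> y) = y"
  by (simp flip: m_assoc)

lemma r_inv_left: "x \<in> carrier G \<Longrightarrow> y \<in> carrier G \<Longrightarrow> x \<otimes> (inv x \<otimes> y) = y"
  by (simp flip: m_assoc)

text \<open>
  The method \<open>algebra\<close> rewrites with respect to a path order that puts \<open>inv x\<close> next to \<open>x\<close>,
  so that these rules cancel; under the order of \<open>simp\<close> they would not.
\<close>

lemmas comm_group_simprules
  [algebra comm_group "one G" "monoid.mult G" "m_inv G"] =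
  m_closed inv_closed one_closed m_assoc m_comm m_lcomm inv_mult inv_inv inv_one
  r_one l_one l_inv r_inv l_inv_left r_inv_left

end

section \<open>Cocycles, coboundaries and the multiplicativity defect of the braiding\<close>

locale abelian_pair = G: comm_group G + M: comm_group M
  for G :: "('g, 'a) monoid_scheme" (structure) and M :: "('m, 'b) monoid_scheme"
begin

abbreviation M_mult (infixl "\<bullet>" 70) where "x \<bullet> y \<equiv> x \<otimes>\<^bsub>M\<^esub> y"
abbreviation M_inv ("(_\<inverse>)" [1000] 999) where "x\<inverse> \<equiv> inv\<^bsub>M\<^esub> x"
abbreviation M_one ("\<one>\<^sub>M") where "\<one>\<^sub>M \<equiv> \<one>\<^bsub>M\<^esub>"

abbreviation "Z \<equiv> two_abelian_cocycles3 G M"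
abbreviation "B \<equiv> two_abelian_coboundaries3 G M"

lemma cocycleI:
  assumes "\<And>x y z. x \<in> carrier G \<Longrightarrow> y \<in> carrier G \<Longrightarrow> z \<in> carrier G \<Longrightarrow> h (x, y, z) \<in> carrier M"
    and "\<And>x y. x \<in> carrier G \<Longrightarrow> y \<in> carrier G \<Longrightarrow> c (x, y) \<in> carrier M"
    and "\<And>x y z w. x \<in> carrier G \<Longrightarrow> y \<in> carrier G \<Longrightarrow> z \<in> carrier G \<Longrightarrow> w \<in> carrier G \<Longrightarrow>
      h (x, y, z) \<bullet> h (x, y \<otimes> z, w) \<bullet> h (y, z, w) = h (x \<otimes> y, z, w) \<bullet> h (x, y, z \<otimes> w)"
    and "\<And>x y z. x \<in> carrier G \<Longrightarrow> y \<in> carrier G \<Longrightarrow> z \<in> carrier G \<Longrightarrow>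
      h (y, z, x) \<bullet> c (x, y \<otimes> z) \<bullet> h (x, y, z) = c (x, z) \<bullet> h (y, x, z) \<bullet> c (x, y)"
    and "\<And>x y z. x \<in> carrier G \<Longrightarrow> y \<in> carrier G \<Longrightarrow> z \<in> carrier G \<Longrightarrow>
      (h (z, x, y))\<inverse> \<bullet> c (x \<otimes> y, z) \<bullet> (h (x, y, z))\<inverse> = c (x, z) \<bullet> (h (x, z, y))\<inverse> \<bullet> c (y, z)"
  shows "(restrict h (carrier G \<times> carrier G \<times> carrier G), restrict c (carrier G \<times> carrier G)) \<in> Z"
  using assms
  by (simp add: two_abelian_cocycles3_def cocycles3_def cochain_group3_def cochain_group2_def PiE_iff)

lemma coboundaryI:
  assumes "(h, c) \<in> Z"
    and "\<And>x y. x \<in> carrier G \<Longrightarrow> y \<in> carrier G \<Longrightarrow> k (x, y) \<in> carrier M"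
    and "\<And>x y z. x \<in> carrier G \<Longrightarrow> y \<in> carrier G \<Longrightarrow> z \<in> carrier G \<Longrightarrow>
      h (x, y, z) = k (y, z) \<bullet> (k (x \<otimes> y, z))\<inverse> \<bullet> k (x, y \<otimes> z) \<bullet> (k (x, y))\<inverse>"
    and "\<And>x y. x \<in> carrier G \<Longrightarrow> y \<in> carrier G \<Longrightarrow> c (x, y) = k (y, x) \<bullet> (k (x, y))\<inverse>"
  shows "(h, c) \<in> B"
proof -
  let ?k = "restrict k (carrier G \<times> carrier G)"
  have ext: "h \<in> extensional (carrier G \<times> carrier G \<times> carrier G)" "c \<in> extensional (carrier G \<times> carrier G)"
    using assms(1)
    by (auto simp: two_abelian_cocycles3_def cocycles3_def cochain_group3_def cochain_group2_def PiE_iff)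
  have "h = coboundary2 G M ?k"
    by (rule extensionalityI[OF ext(1)]) (auto simp: coboundary2_def assms)
  moreover have "c = commutator2 G M ?k"
    by (rule extensionalityI[OF ext(2)]) (auto simp: commutator2_def assms)
  moreover have "?k \<in> carrier (cochain_group2 G M)"
    using assms by (auto simp: cochain_group2_def)
  ultimately show ?thesis
    unfolding two_abelian_coboundaries3_def by blast
qed

lemma coboundaryE:
  assumes "(h, c) \<in> B"
  obtains k where "k \<in> carrier (cochain_group2 G M)" "h = coboundary2 G M k" "c = commutator2 G M k"
  using assms by (auto simp: two_abelian_coboundaries3_def)

lemma mult_cocycle:
  assumes "(h, c) \<in> Z" "(h', c') \<in> Z"
  shows "(\<lambda>i\<in>carrier G \<times> carrier G \<times> carrier G. h i \<bullet> h' i, \<lambda>i\<in>carrier G \<times> carrier G. c i \<bullet> c' i) \<in> Z"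
  using subgroup.m_closed[OF subgroup_two_abelian_cocycles3[OF G.comm_group_axioms M.comm_group_axioms] assms]
  by (simp add: cochain_group3_def cochain_group2_def)

lemma coboundary_cocycle: "(h, c) \<in> B \<Longrightarrow> (h, c) \<in> Z"
  using two_abelian_coboundaries3_subset[OF G.comm_group_axioms M.comm_group_axioms] by blast

end

locale two_abelian_cocycle = abelian_pair +
  fixes h :: "'a \<times> 'a \<times> 'a \<Rightarrow> 'c" and c :: "'a \<times> 'a \<Rightarrow> 'c"
  assumes cocycle: "(h, c) \<in> Z"
begin

lemma h_closed [simp]:
  "x \<in> carrier G \<Longrightarrow> y \<in> carrier G \<Longrightarrow> z \<in> carrier G \<Longrightarrow> h (x, y, z) \<in> carrier M"
  and c_closed [simp]: "x \<in> carrier G \<Longrightarrow> y \<in> carrier G \<Longrightarrow> c (x, y) \<in> carrier M"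
  and pentagon: "x \<in> carrier G \<Longrightarrow> y \<in> carrier G \<Longrightarrow> z \<in> carrier G \<Longrightarrow> w \<in> carrier G \<Longrightarrow>
      h (x, y, z) \<bullet> h (x, y \<otimes> z, w) \<bullet> h (y, z, w) = h (x \<otimes> y, z, w) \<bullet> h (x, y, z \<otimes> w)"
  and hexagon1: "x \<in> carrier G \<Longrightarrow> y \<in> carrier G \<Longrightarrow> z \<in> carrier G \<Longrightarrow>
      h (y, z, x) \<bullet> c (x, y \<otimes> z) \<bullet> h (x, y, z) = c (x, z) \<bullet> h (y, x, z) \<bullet> c (x, y)"
  and hexagon2: "x \<in> carrier G \<Longrightarrow> y \<in> carrier G \<Longrightarrow> z \<in> carrier G \<Longrightarrow>
      (h (z, x, y))\<inverse> \<bullet> c (x \<otimes> y, z) \<bullet> (h (x, y, z))\<inverse> = c (x, z) \<bullet> (h (x, z, y))\<inverse> \<bullet> c (y, z)"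
  using cocycle
  by (auto simp: two_abelian_cocycles3_def cocycles3_def cochain_group3_def cochain_group2_def PiE_iff)

lemma h_one: "h (\<one>, \<one>, \<one>) = \<one>\<^sub>M"
  using pentagon[of \<one> \<one> \<one> \<one>] by simp

text \<open>The first hexagon solved for the braiding with a product. With its counterpart for the
  left variable, the hexagons become rewrite rules that make \<open>c\<close> multiplicative in each
  variable up to associators.\<close>

lemma c_mult_right:
  assumes x: "x \<in> carrier G" "y \<in> carrier G" "z \<in> carrier G"
  shows "c (x, y \<otimes> z) = c (x, y) \<bullet> c (x, z) \<bullet> h (y, x, z) \<bullet> (h (y, z, x))\<inverse> \<bullet> (h (x, y, z))\<inverse>"
proof -
  have *: "u = p \<bullet> q \<bullet> s \<bullet> r\<inverse> \<bullet> t\<inverse>" if "r \<bullet> u \<bullet> t = q \<bullet> s \<bullet> p"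
    "u \<in> carrier M" "p \<in> carrier M" "q \<in> carrier M" "r \<in> carrier M" "s \<in> carrier M" "t \<in> carrier M"
    for p q r s t u
  proof -
    have "u = (r \<bullet> u \<bullet> t) \<bullet> r\<inverse> \<bullet> t\<inverse>" using that(2-) by algebra
    also have "\<dots> = p \<bullet> q \<bullet> s \<bullet> r\<inverse> \<bullet> t\<inverse>" unfolding that(1) using that(2-) by algebra
    finally show ?thesis .
  qed
  show ?thesis by (rule *[OF hexagon1[OF x]]) (use x in simp_all)
qed

lemma c_mult_left:
  assumes x: "x \<in> carrier G" "y \<in> carrier G" "z \<in> carrier G"
  shows "c (x \<otimes> y, z) = c (x, z) \<bullet> c (y, z) \<bullet> (h (x, z, y))\<inverse> \<bullet> h (z, x, y) \<bullet> h (x, y, z)"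
proof -
  have *: "u = p \<bullet> q \<bullet> s\<inverse> \<bullet> r \<bullet> t" if "r\<inverse> \<bullet> u \<bullet> t\<inverse> = p \<bullet> s\<inverse> \<bullet> q"
    "u \<in> carrier M" "p \<in> carrier M" "q \<in> carrier M" "r \<in> carrier M" "s \<in> carrier M" "t \<in> carrier M"
    for p q r s t u
  proof -
    have "u = (r\<inverse> \<bullet> u \<bullet> t\<inverse>) \<bullet> r \<bullet> t" using that(2-) by algebra
    also have "\<dots> = p \<bullet> q \<bullet> s\<inverse> \<bullet> r \<bullet> t" unfolding that(1) using that(2-) by algebra
    finally show ?thesis .
  qed
  show ?thesis by (rule *[OF hexagon2[OF x]]) (use x in simp_all)
qed

lemma c_one: "c (\<one>, \<one>) = \<one>\<^sub>M"
  using hexagon1[of \<one> \<one> \<one>] by (simp add: h_one)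

text \<open>The associators left over are exactly the pentagon for \<open>x, y, x, y\<close>.\<close>

lemma trace_mult:
  assumes x: "x \<in> carrier G" "y \<in> carrier G"
  shows "c (x \<otimes> y, x \<otimes> y) = c (x, x) \<bullet> c (y, y) \<bullet> (c (x, y) \<bullet> c (y, x))"
proof -
  have p: "h (x, x \<otimes> y, y) = h (x \<otimes> y, x, y) \<bullet> h (x, y, x \<otimes> y) \<bullet> (h (x, y, x))\<inverse> \<bullet> (h (y, x, y))\<inverse>"
  proof -
    have *: "b = d \<bullet> e \<bullet> a\<inverse> \<bullet> f\<inverse>" if "a \<bullet> b \<bullet> f = d \<bullet> e" "a \<in> carrier M" "b \<in> carrier M"
      "f \<in> carrier M" "d \<in> carrier M" "e \<in> carrier M" for a b d e f
    proof -
      have "b = (a \<bullet> b \<bullet> f) \<bullet> a\<inverse> \<bullet> f\<inverse>" using that(2-) by algebra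
      also have "\<dots> = d \<bullet> e \<bullet> a\<inverse> \<bullet> f\<inverse>" unfolding that(1) using that(2-) by algebra
      finally show ?thesis .
    qed
    show ?thesis
      by (rule *) (use x pentagon[of x y x y] in \<open>simp_all add: G.m_comm[of y x]\<close>)
  qed
  have cl: "c (x, x) \<in> carrier M" "c (y, y) \<in> carrier M" "c (x, y) \<in> carrier M" "c (y, x) \<in> carrier M"
    "h (x, y, x) \<in> carrier M" "h (y, x, y) \<in> carrier M" "h (x, x, y) \<in> carrier M" "h (x, y, y) \<in> carrier M"
    "h (x \<otimes> y, x, y) \<in> carrier M" "h (x, y, x \<otimes> y) \<in> carrier M" using x by simp_all
  show ?thesis
    unfolding c_mult_right[OF G.m_closed[OF x] x] c_mult_left[OF x x(1)] c_mult_left[OF x x(2)] p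
    using cl by algebra
qed

text \<open>The associators contributed by the two hexagons are inverse to each other, so the double
  braiding is bilinear even where \<open>c\<close> is not.\<close>

lemma double_braiding_mult:
  assumes x: "x \<in> carrier G" "y \<in> carrier G" "z \<in> carrier G"
  shows "c (x, y \<otimes> z) \<bullet> c (y \<otimes> z, x) = (c (x, y) \<bullet> c (y, x)) \<bullet> (c (x, z) \<bullet> c (z, x))"
proof -
  have cl: "c (x, y) \<in> carrier M" "c (x, z) \<in> carrier M" "c (y, x) \<in> carrier M" "c (z, x) \<in> carrier M"
    "h (y, x, z) \<in> carrier M" "h (y, z, x) \<in> carrier M" "h (x, y, z) \<in> carrier M"
    using x by simp_all
  show ?thesis
    unfolding c_mult_right[OF x] c_mult_left[OF x(2,3,1)] using cl by algebra
qed

end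

section \<open>Quadratic forms\<close>

lemma (in comm_group) eq_mult_inv_iff:
  "\<lbrakk>x \<in> carrier G; y \<in> carrier G; z \<in> carrier G\<rbrakk> \<Longrightarrow> x = y \<otimes> inv z \<longleftrightarrow> x \<otimes> z = y"
  by (metis inv_solve_right)

locale quadratic_form = abelian_pair +
  fixes q :: "'a \<Rightarrow> 'c"
  assumes quadratic: "q \<in> quadratic_forms G M"
begin

abbreviation "b \<equiv> polarization G M q"

lemma q_closed [simp]: "x \<in> carrier G \<Longrightarrow> q x \<in> carrier M"
  and q_inv [simp]: "x \<in> carrier G \<Longrightarrow> q (inv x) = q x"
  using quadratic by (auto simp: quadratic_forms_def cochain_group1_def)

lemma b_hom: "x \<in> carrier G \<Longrightarrow> (\<lambda>y. b x y) \<in> hom G M" "y \<in> carrier G \<Longrightarrow> (\<lambda>x. b x y) \<in> hom G M"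
  using quadratic by (auto simp: quadratic_forms_def bilinear_map_def)

lemma b_closed [simp]: "x \<in> carrier G \<Longrightarrow> y \<in> carrier G \<Longrightarrow> b x y \<in> carrier M"
  by (simp add: polarization_def)

lemma b_mult_right: "x \<in> carrier G \<Longrightarrow> y \<in> carrier G \<Longrightarrow> z \<in> carrier G \<Longrightarrow> b x (y \<otimes> z) = b x y \<bullet> b x z"
  using hom_mult[OF b_hom(1)] by auto

lemma b_mult_left: "x \<in> carrier G \<Longrightarrow> y \<in> carrier G \<Longrightarrow> z \<in> carrier G \<Longrightarrow> b (x \<otimes> y) z = b x z \<bullet> b y z"
  using hom_mult[OF b_hom(2)] by auto

lemma b_one [simp]: "x \<in> carrier G \<Longrightarrow> b \<one> x = \<one>\<^sub>M" "x \<in> carrier G \<Longrightarrow> b x \<one> = \<one>\<^sub>M"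
  using hom_one[OF b_hom(1)] hom_one[OF b_hom(2)] G.group_axioms M.group_axioms by blast+

lemma q_mult: "x \<in> carrier G \<Longrightarrow> y \<in> carrier G \<Longrightarrow> q (x \<otimes> y) = q x \<bullet> q y \<bullet> b x y"
proof -
  assume x: "x \<in> carrier G" "y \<in> carrier G"
  have "q x \<in> carrier M" "q y \<in> carrier M" "q (x \<otimes> y) \<in> carrier M" using x by auto
  then show ?thesis unfolding polarization_def by algebra
qed

lemma q_one [simp]: "q \<one> = \<one>\<^sub>M"
  using q_mult[of \<one> \<one>] by simp

text \<open>Both sides are inverse to \<open>b x (inv x)\<close>: the left one by bilinearity, the
  right one by evaluating \<open>q\<close> at \<open>x \<otimes> inv x\<close> and using that
  \<open>q\<close> is even.\<close>

lemma b_self: assumes x: "x \<in> carrier G" shows "b x x = q x \<bullet> q x"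
proof -
  have "b x x \<bullet> b x (inv x) = \<one>\<^sub>M"
    using b_mult_right[of x x "inv x"] x by simp
  moreover have "q x \<bullet> q x \<bullet> b x (inv x) = \<one>\<^sub>M"
    using q_mult[of x "inv x"] x by simp
  ultimately show ?thesis using x by (metis M.inv_equality M.inv_inv M.m_closed b_closed G.inv_closed q_closed)
qed

lemma b_int_pow_self: assumes a: "a \<in> carrier G" shows "b (a [^] (i::int)) a = q a [^]\<^bsub>M\<^esub> (2 * i)"
proof -
  interpret H: group_hom G M "\<lambda>x. b x a"
    using b_hom(2)[OF a] by unfold_locales
  have "b (a [^] i) a = (q a \<bullet> q a) [^]\<^bsub>M\<^esub> i"
    using H.hom_int_pow[OF a] b_self[OF a] by simp
  also have "q a \<bullet> q a = q a [^]\<^bsub>M\<^esub> (2::int)"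
    using a M.int_pow_mult[of "q a" 1 1] by simp
  finally show ?thesis using a by (simp add: M.int_pow_pow)
qed

lemma q_int_pow: assumes a: "a \<in> carrier G" shows "q (a [^] (i::int)) = q a [^]\<^bsub>M\<^esub> (i * i)"
proof -
  \<comment> \<open>The difference \<open>2 * i + 1\<close> of consecutive squares arises from
    \<open>b (a [^] i) a\<close> and \<open>q a\<close>. The same formula, read backwards, serves
    the descending half of the integer induction.\<close>
  have step: "q (a [^] (i + 1)) = q (a [^] i) \<bullet> q a [^]\<^bsub>M\<^esub> (2 * i + 1)" for i :: int
    using a by (simp add: G.int_pow_mult q_mult b_int_pow_self M.int_pow_mult M.m_ac)
  show ?thesis
  proof (induction i rule: int_induct[where k = 0])
    case base
    then show ?case using a by simp
  next
    case (step1 i)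
    have "(i + 1) * (i + 1) = i * i + (2 * i + 1)" by (simp add: algebra_simps)
    then show ?case using step[of i] step1 a by (simp add: M.int_pow_mult)
  next
    case (step2 i)
    have "q a [^]\<^bsub>M\<^esub> (i * i) = q (a [^] (i - 1)) \<bullet> q a [^]\<^bsub>M\<^esub> (2 * (i - 1) + 1)"
      using step[of "i - 1"] step2 by simp
    then have "q (a [^] (i - 1)) = q a [^]\<^bsub>M\<^esub> (i * i) \<bullet> (q a [^]\<^bsub>M\<^esub> (2 * (i - 1) + 1))\<inverse>"
      using a by (simp add: M.eq_mult_inv_iff)
    also have "\<dots> = q a [^]\<^bsub>M\<^esub> (i * i - (2 * (i - 1) + 1))"
      using a by (simp add: M.int_pow_diff)
    also have "i * i - (2 * (i - 1) + 1) = (i - 1) * (i - 1)" by (simp add: algebra_simps)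
    finally show ?case .
  qed
qed

end

section \<open>The trace of a cocycle as a quadratic form\<close>

context two_abelian_cocycle
begin

lemma double_braiding_one: "x \<in> carrier G \<Longrightarrow> c (x, \<one>) \<bullet> c (\<one>, x) = \<one>\<^sub>M"
  using double_braiding_mult[of x \<one> \<one>] by simp

text \<open>By \<open>trace_mult\<close> the polarization of the trace is the double braiding, so
  its bilinearity is \<open>double_braiding_mult\<close>.\<close>

lemma trace_quadratic: "(\<lambda>x\<in>carrier G. c (x, x)) \<in> quadratic_forms G M"
proof -
  let ?q = "\<lambda>x\<in>carrier G. c (x, x)"
  have pol: "polarization G M ?q x y = c (x, y) \<bullet> c (y, x)"
    if x: "x \<in> carrier G" "y \<in> carrier G" for x y
  proof -
    have "c (x, x) \<in> carrier M" "c (y, y) \<in> carrier M" "c (x, y) \<in> carrier M" "c (y, x) \<in> carrier M"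
      using x by auto
    then have "c (x, x) \<bullet> c (y, y) \<bullet> (c (x, y) \<bullet> c (y, x)) \<bullet> (c (x, x))\<inverse> \<bullet> (c (y, y))\<inverse> = c (x, y) \<bullet> c (y, x)"
      by algebra
    then show ?thesis using x by (simp add: polarization_def trace_mult)
  qed
  have comm: "c (x, y) \<bullet> c (y, x) = c (y, x) \<bullet> c (x, y)" if "x \<in> carrier G" "y \<in> carrier G" for x y
    using that by (simp add: M.m_comm)
  \<comment> \<open>Multiplicativity of the double braiding and \<open>trace_mult\<close>, each
    applied to \<open>x \<otimes> inv x\<close>, yield two relations that differ in one factor only:
    \<open>c (x, x)\<close> in the first, \<open>c (inv x, inv x)\<close> in the second.\<close>
  have "c (inv x, inv x) = c (x, x)" if x: "x \<in> carrier G" for x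
  proof -
    have 1: "(c (x, x) \<bullet> c (x, x)) \<bullet> (c (x, inv x) \<bullet> c (inv x, x)) = \<one>\<^sub>M"
      using double_braiding_mult[of x x "inv x"] double_braiding_one[of x] x by simp
    have 2: "c (x, x) \<bullet> c (inv x, inv x) \<bullet> (c (x, inv x) \<bullet> c (inv x, x)) = \<one>\<^sub>M"
      using trace_mult[of x "inv x"] c_one x by simp
    have *: "v = u" if "u \<bullet> u \<bullet> w = \<one>\<^sub>M" "u \<bullet> v \<bullet> w = \<one>\<^sub>M"
      "u \<in> carrier M" "v \<in> carrier M" "w \<in> carrier M" for u v w
      by (metis that M.l_cancel M.m_closed M.r_cancel)
    show ?thesis by (rule *[OF 1 2]) (use x in simp_all)
  qed
  then show ?thesis
    by (auto simp: quadratic_forms_def cochain_group1_def bilinear_map_def hom_def pol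
        double_braiding_mult comm)
qed

end

section \<open>Pullbacks and cohomologous cocycles\<close>

text \<open>Only the domain of the homomorphism \<open>f\<close> is a parameter: it fixes where the
  resulting functions are defined. The same definition thus serves inclusions of subgroups and
  projections onto them.\<close>

definition pullback where
  "pullback G f = (\<lambda>(h, c). (\<lambda>(x, y, z)\<in>carrier G \<times> carrier G \<times> carrier G. h (f x, f y, f z),
    \<lambda>(x, y)\<in>carrier G \<times> carrier G. c (f x, f y)))"

context abelian_pair
begin

lemma
  fixes H (structure)
  assumes H: "comm_group H" and f: "f \<in> hom G H"
  shows pullback_cocycle: "hc \<in> two_abelian_cocycles3 H M \<Longrightarrow> pullback G f hc \<in> Z"
    and pullback_coboundary: "hc \<in> two_abelian_coboundaries3 H M \<Longrightarrow> pullback G f hc \<in> B"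
proof -
  have HM: "abelian_pair H M" by (intro abelian_pair.intro H M.comm_group_axioms)
  have [simp]: "f x \<in> carrier H" if "x \<in> carrier G" for x using f that by (auto simp: hom_def)
  have [simp]: "f (x \<otimes>\<^bsub>G\<^esub> y) = f x \<otimes>\<^bsub>H\<^esub> f y" if "x \<in> carrier G" "y \<in> carrier G" for x y
    using f that by (auto simp: hom_def)
  show *: "pullback G f hc \<in> Z" if "hc \<in> two_abelian_cocycles3 H M" for hc
  proof -
    obtain h c where hc: "hc = (h, c)" by fastforce
    have *: "two_abelian_cocycle H M h c"
      using HM that hc by (simp add: two_abelian_cocycle_def two_abelian_cocycle_axioms_def)
    show ?thesis unfolding hc pullback_def prod.case
      by (rule cocycleI) (simp_all add: two_abelian_cocycle.h_closed[OF *] two_abelian_cocycle.c_closed[OF *] two_abelian_cocycle.pentagon[OF *]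
          two_abelian_cocycle.hexagon1[OF *] two_abelian_cocycle.hexagon2[OF *])
  qed
  show "pullback G f hc \<in> B" if "hc \<in> two_abelian_coboundaries3 H M"
  proof -
    obtain h c where hc: "hc = (h, c)" by fastforce
    from that[unfolded hc] obtain k where k: "k \<in> carrier (cochain_group2 H M)" "h = coboundary2 H M k" "c = commutator2 H M k"
      by (rule abelian_pair.coboundaryE[OF HM])
    have "pullback G f (h, c) \<in> Z" by (rule *[OF abelian_pair.coboundary_cocycle[OF HM that[unfolded hc]]])
    then show ?thesis unfolding hc pullback_def prod.case
      by (rule coboundaryI[where k = "\<lambda>(x, y). k (f x, f y)"]) (use k(1) in \<open>auto simp: k(2,3) cochain_group2_def coboundary2_def commutator2_def\<close>)
  qed
qed

text \<open>The tool for dividing a cocycle by the coboundary of a chosen cochain \<open>k\<close>.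
  The new cocycle is given by explicit values, and the last conclusion transfers the coboundary
  property back to the original one.\<close>

lemma cohomologous:
  assumes hc: "(h, c) \<in> Z"
    and k: "\<And>x y. x \<in> carrier G \<Longrightarrow> y \<in> carrier G \<Longrightarrow> k (x, y) \<in> carrier M"
  obtains h' c' where "(h', c') \<in> Z"
    and "\<forall>x\<in>carrier G. \<forall>y\<in>carrier G. \<forall>z\<in>carrier G.
      h' (x, y, z) = h (x, y, z) \<bullet> (k (y, z))\<inverse> \<bullet> k (x \<otimes> y, z) \<bullet> (k (x, y \<otimes> z))\<inverse> \<bullet> k (x, y)"
    and "\<forall>x\<in>carrier G. \<forall>y\<in>carrier G. c' (x, y) = c (x, y) \<bullet> (k (y, x))\<inverse> \<bullet> k (x, y)"
    and "(h', c') \<in> B \<longrightarrow> (h, c) \<in> B"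
proof -
  interpret two_abelian_cocycle G M h c by unfold_locales (rule hc)
  \<comment> \<open>The pointwise inverse of \<open>k\<close>, restricted so that it is a genuine
    cochain; multiplying by its coboundary divides by that of \<open>k\<close>.\<close>
  define l where "l = (\<lambda>i\<in>carrier G \<times> carrier G. (k i)\<inverse>)"
  have l: "l \<in> carrier (cochain_group2 G M)" using k by (auto simp: l_def cochain_group2_def)
  then have lB: "(coboundary2 G M l, commutator2 G M l) \<in> B"
    by (auto simp: two_abelian_coboundaries3_def)
  define h' where "h' = (\<lambda>i\<in>carrier G \<times> carrier G \<times> carrier G. h i \<bullet> coboundary2 G M l i)"
  define c' where "c' = (\<lambda>i\<in>carrier G \<times> carrier G. c i \<bullet> commutator2 G M l i)"
  have Z': "(h', c') \<in> Z" unfolding h'_def c'_def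
    by (rule mult_cocycle[OF hc coboundary_cocycle[OF lB]])
  have h': "h' (x, y, z) = h (x, y, z) \<bullet> (k (y, z))\<inverse> \<bullet> k (x \<otimes> y, z) \<bullet> (k (x, y \<otimes> z))\<inverse> \<bullet> k (x, y)"
    if "x \<in> carrier G" "y \<in> carrier G" "z \<in> carrier G" for x y z
    using that k by (simp add: h'_def coboundary2_def l_def M.m_assoc)
  have c': "c' (x, y) = c (x, y) \<bullet> (k (y, x))\<inverse> \<bullet> k (x, y)"
    if "x \<in> carrier G" "y \<in> carrier G" for x y
    using that k by (simp add: c'_def commutator2_def l_def M.m_assoc)
  show thesis
  proof (rule that[OF Z'])
    show "\<forall>x\<in>carrier G. \<forall>y\<in>carrier G. \<forall>z\<in>carrier G.
      h' (x, y, z) = h (x, y, z) \<bullet> (k (y, z))\<inverse> \<bullet> k (x \<otimes> y, z) \<bullet> (k (x, y \<otimes> z))\<inverse> \<bullet> k (x, y)"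
      by (simp add: h')
    show "\<forall>x\<in>carrier G. \<forall>y\<in>carrier G. c' (x, y) = c (x, y) \<bullet> (k (y, x))\<inverse> \<bullet> k (x, y)"
      by (simp add: c')
    show "(h', c') \<in> B \<longrightarrow> (h, c) \<in> B"
    proof
      assume "(h', c') \<in> B"
      then obtain m where m: "m \<in> carrier (cochain_group2 G M)" "h' = coboundary2 G M m" "c' = commutator2 G M m"
        by (rule coboundaryE)
      have mc: "m (x, y) \<in> carrier M" if "x \<in> carrier G" "y \<in> carrier G" for x y
        using m(1) that by (auto simp: cochain_group2_def)
      have mh: "h' (x, y, z) = m (y, z) \<bullet> (m (x \<otimes> y, z))\<inverse> \<bullet> m (x, y \<otimes> z) \<bullet> (m (x, y))\<inverse>"
        if "x \<in> carrier G" "y \<in> carrier G" "z \<in> carrier G" for x y z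
        using that by (simp add: m(2) coboundary2_def)
      have mm: "c' (x, y) = m (y, x) \<bullet> (m (x, y))\<inverse>" if "x \<in> carrier G" "y \<in> carrier G" for x y
        using that by (simp add: m(3) commutator2_def)
      have *: "u = (a \<bullet> p) \<bullet> (b \<bullet> q)\<inverse> \<bullet> (d \<bullet> r) \<bullet> (e \<bullet> s)\<inverse>"
        if "u \<bullet> p\<inverse> \<bullet> q \<bullet> r\<inverse> \<bullet> s = a \<bullet> b\<inverse> \<bullet> d \<bullet> e\<inverse>" and "u \<in> carrier M" "p \<in> carrier M"
          "q \<in> carrier M" "r \<in> carrier M" "s \<in> carrier M" "a \<in> carrier M" "b \<in> carrier M" "d \<in> carrier M"
          "e \<in> carrier M" for u p q r s a b d e
      proof -
        have "u = (u \<bullet> p\<inverse> \<bullet> q \<bullet> r\<inverse> \<bullet> s) \<bullet> (p \<bullet> q\<inverse> \<bullet> r \<bullet> s\<inverse>)" using that(2-) by algebra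
        also have "\<dots> = (a \<bullet> p) \<bullet> (b \<bullet> q)\<inverse> \<bullet> (d \<bullet> r) \<bullet> (e \<bullet> s)\<inverse>"
          unfolding that(1) using that(2-) by algebra
        finally show ?thesis .
      qed
      have **: "u = (a \<bullet> p) \<bullet> (b \<bullet> q)\<inverse>"
        if "u \<bullet> p\<inverse> \<bullet> q = a \<bullet> b\<inverse>" and "u \<in> carrier M" "p \<in> carrier M"
          "q \<in> carrier M" "a \<in> carrier M" "b \<in> carrier M" for u p q a b
      proof -
        have "u = (u \<bullet> p\<inverse> \<bullet> q) \<bullet> (p \<bullet> q\<inverse>)" using that(2-) by algebra
        also have "\<dots> = (a \<bullet> p) \<bullet> (b \<bullet> q)\<inverse>"
          unfolding that(1) using that(2-) by algebra
        finally show ?thesis .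
      qed
      show "(h, c) \<in> B"
      \<comment> \<open>If \<open>m\<close> bounds the modified cocycle, then the product of
        \<open>m\<close> and \<open>k\<close> bounds the original one.\<close>
      proof (rule coboundaryI[OF hc, where k = "\<lambda>i. m i \<bullet> k i"])
        fix x y z assume x: "x \<in> carrier G" "y \<in> carrier G" "z \<in> carrier G"
        show "h (x, y, z) = (m (y, z) \<bullet> k (y, z)) \<bullet> (m (x \<otimes> y, z) \<bullet> k (x \<otimes> y, z))\<inverse>
          \<bullet> (m (x, y \<otimes> z) \<bullet> k (x, y \<otimes> z)) \<bullet> (m (x, y) \<bullet> k (x, y))\<inverse>"
          by (rule *) (use x mc k in \<open>simp_all add: h'[symmetric] mh[symmetric]\<close>)
      next
        fix x y assume x: "x \<in> carrier G" "y \<in> carrier G"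
        show "c (x, y) = (m (y, x) \<bullet> k (y, x)) \<bullet> (m (x, y) \<bullet> k (x, y))\<inverse>"
          by (rule **) (use x mc k in \<open>simp_all add: c'[symmetric] mm[symmetric]\<close>)
      qed (use mc k in simp)
    qed
  qed
qed

end

section \<open>Normalization\<close>

context abelian_pair
begin

lemma normalize_cocycle:
  assumes "(h, c) \<in> Z"
  obtains h' c' where "(h', c') \<in> Z"
    and "\<forall>x\<in>carrier G. h' (\<one>, \<one>, x) = \<one>\<^sub>M \<and> h' (x, \<one>, \<one>) = \<one>\<^sub>M \<and> c' (x, x) = c (x, x)"
    and "(h', c') \<in> B \<longrightarrow> (h, c) \<in> B"
proof -
  interpret two_abelian_cocycle G M h c by unfold_locales (rule assms)
  \<comment> \<open>At \<open>(\<one>, \<one>, x)\<close> the coboundary of \<open>k\<close> leaves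
    only \<open>k (\<one>, x)\<close> up to \<open>k (\<one>, \<one>)\<close>, and at
    \<open>(x, \<one>, \<one>)\<close> only the inverse of \<open>k (x, \<one>)\<close>; both cases
    are chosen to absorb \<open>h\<close>. They agree at the unit because of \<open>h_one\<close>,
    and the diagonal of \<open>c\<close> is unchanged since a commutator vanishes there.\<close>
  define k where "k = (\<lambda>(x, y). if x = \<one> then h (\<one>, \<one>, y) else if y = \<one> then (h (x, \<one>, \<one>))\<inverse> else \<one>\<^sub>M)"
  have k: "k (x, y) \<in> carrier M" if "x \<in> carrier G" "y \<in> carrier G" for x y
    using that by (auto simp: k_def)
  obtain h' c' where h': "(h', c') \<in> Z"
    "\<forall>x\<in>carrier G. \<forall>y\<in>carrier G. \<forall>z\<in>carrier G.
      h' (x, y, z) = h (x, y, z) \<bullet> (k (y, z))\<inverse> \<bullet> k (x \<otimes> y, z) \<bullet> (k (x, y \<otimes> z))\<inverse> \<bullet> k (x, y)"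
    "\<forall>x\<in>carrier G. \<forall>y\<in>carrier G. c' (x, y) = c (x, y) \<bullet> (k (y, x))\<inverse> \<bullet> k (x, y)"
    "(h', c') \<in> B \<longrightarrow> (h, c) \<in> B"
    using cohomologous[where k = k, OF assms k] .
  have "h' (\<one>, \<one>, x) = \<one>\<^sub>M \<and> h' (x, \<one>, \<one>) = \<one>\<^sub>M \<and> c' (x, x) = c (x, x)"
    if x: "x \<in> carrier G" for x
    using x k[of x x] by (simp add: h'(2,3) k_def h_one M.m_assoc)
  then show thesis
    using that[OF h'(1) _ h'(4)] by blast
qed

end

text \<open>Besides the trivial trace, a normalization is imposed. Two families of values suffice
  for it: the pentagon with two unit arguments then kills \<open>h\<close> as soon as one argument
  is the unit.\<close>

locale traceless_cocycle = two_abelian_cocycle +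
  assumes h_one_one_left: "x \<in> carrier G \<Longrightarrow> h (\<one>, \<one>, x) = \<one>\<^sub>M"
    and h_one_one_right: "x \<in> carrier G \<Longrightarrow> h (x, \<one>, \<one>) = \<one>\<^sub>M"
    and traceless: "x \<in> carrier G \<Longrightarrow> c (x, x) = \<one>\<^sub>M"
begin

lemma h_one_mid [simp]: "x \<in> carrier G \<Longrightarrow> y \<in> carrier G \<Longrightarrow> h (x, \<one>, y) = \<one>\<^sub>M"
  using pentagon[of x \<one> \<one> y] by (simp add: h_one_one_left h_one_one_right)

lemma h_one_left [simp]: "x \<in> carrier G \<Longrightarrow> y \<in> carrier G \<Longrightarrow> h (\<one>, x, y) = \<one>\<^sub>M"
  using pentagon[of \<one> \<one> x y] by (simp add: h_one_one_left)

lemma h_one_right [simp]: "x \<in> carrier G \<Longrightarrow> y \<in> carrier G \<Longrightarrow> h (x, y, \<one>) = \<one>\<^sub>M"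
  using pentagon[of x y \<one> \<one>] by (simp add: h_one_one_right)

lemma c_one_right [simp]: "x \<in> carrier G \<Longrightarrow> c (x, \<one>) = \<one>\<^sub>M"
  using c_mult_right[of x \<one> \<one>] by simp

lemma c_one_left [simp]: "x \<in> carrier G \<Longrightarrow> c (\<one>, x) = \<one>\<^sub>M"
  using c_mult_left[of \<one> \<one> x] by simp

text \<open>The double braiding is the polarization of the trace, which is trivial here.\<close>

lemma c_antisym: "x \<in> carrier G \<Longrightarrow> y \<in> carrier G \<Longrightarrow> c (x, y) \<bullet> c (y, x) = \<one>\<^sub>M"
  using trace_mult[of x y] by (simp add: traceless)

end

text \<open>Reduction to normalized cocycles; normalizing preserves the trace.\<close>

lemma (in abelian_pair) coboundary_if_traceless:
  assumes "\<And>h c. traceless_cocycle G M h c \<Longrightarrow> (h, c) \<in> B"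
    and "(h, c) \<in> Z" and "\<And>x. x \<in> carrier G \<Longrightarrow> c (x, x) = \<one>\<^sub>M"
  shows "(h, c) \<in> B"
proof -
  obtain h' c' where "(h', c') \<in> Z"
    "\<forall>x\<in>carrier G. h' (\<one>, \<one>, x) = \<one>\<^sub>M \<and> h' (x, \<one>, \<one>) = \<one>\<^sub>M \<and> c' (x, x) = c (x, x)"
    and B: "(h', c') \<in> B \<longrightarrow> (h, c) \<in> B"
    using normalize_cocycle[OF assms(2)] .
  then have "traceless_cocycle G M h' c'"
    by unfold_locales (simp_all add: assms(3))
  then show ?thesis
    using B assms(1) by blast
qed

text \<open>The hexagons supply the placements of summand elements that the hypotheses leave out.
  Pentagons then replace arguments in one summand by arbitrary ones, one argument at a time.\<close>

lemma (in two_abelian_cocycle) trivial_if_trivial_on_summands: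
  assumes A: "A \<subseteq> carrier G" "\<And>x y. x \<in> A \<Longrightarrow> y \<in> A \<Longrightarrow> x \<otimes> y \<in> A"
    and B: "D \<subseteq> carrier G" "\<And>x y. x \<in> D \<Longrightarrow> y \<in> D \<Longrightarrow> x \<otimes> y \<in> D"
    and AB: "\<And>x. x \<in> carrier G \<Longrightarrow> \<exists>a\<in>A. \<exists>b\<in>D. x = a \<otimes> b"
    and c_antisym: "\<And>x y. x \<in> carrier G \<Longrightarrow> y \<in> carrier G \<Longrightarrow> c (x, y) \<bullet> c (y, x) = \<one>\<^sub>M"
    and hA: "\<And>x y z. x \<in> A \<Longrightarrow> y \<in> A \<Longrightarrow> z \<in> A \<Longrightarrow> h (x, y, z) = \<one>\<^sub>M"
    and hB: "\<And>x y z. x \<in> D \<Longrightarrow> y \<in> D \<Longrightarrow> z \<in> D \<Longrightarrow> h (x, y, z) = \<one>\<^sub>M"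
    and cA: "\<And>x y. x \<in> A \<Longrightarrow> y \<in> A \<Longrightarrow> c (x, y) = \<one>\<^sub>M"
    and cB: "\<And>x y. x \<in> D \<Longrightarrow> y \<in> D \<Longrightarrow> c (x, y) = \<one>\<^sub>M"
    and ABy: "\<And>a b y. a \<in> A \<Longrightarrow> b \<in> D \<Longrightarrow> y \<in> carrier G \<Longrightarrow> h (a, b, y) = \<one>\<^sub>M"
    and AAB: "\<And>a b y. a \<in> A \<Longrightarrow> b \<in> A \<Longrightarrow> y \<in> D \<Longrightarrow> h (a, b, y) = \<one>\<^sub>M"
    and BAB: "\<And>a b y. a \<in> D \<Longrightarrow> b \<in> A \<Longrightarrow> y \<in> D \<Longrightarrow> h (a, b, y) = \<one>\<^sub>M"
    and cBA: "\<And>x y. x \<in> D \<Longrightarrow> y \<in> A \<Longrightarrow> c (x, y) = \<one>\<^sub>M"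
  shows "x \<in> carrier G \<Longrightarrow> y \<in> carrier G \<Longrightarrow> z \<in> carrier G \<Longrightarrow> h (x, y, z) = \<one>\<^sub>M"
    and "x \<in> carrier G \<Longrightarrow> y \<in> carrier G \<Longrightarrow> c (x, y) = \<one>\<^sub>M"
proof -
  note [simp] = A(2) B(2) hA hB cA cB ABy AAB BAB cBA
  have [simp]: "x \<in> carrier G" if "x \<in> A" for x using that A by blast
  have [simp]: "x \<in> carrier G" if "x \<in> D" for x using that B by blast
  have cAB[simp]: "c (a, b) = \<one>\<^sub>M" if "a \<in> A" "b \<in> D" for a b
    using c_antisym[of a b] that by simp
  have BAA[simp]: "h (b, a, a') = \<one>\<^sub>M" if "a \<in> A" "a' \<in> A" "b \<in> D" for a a' b
    using hexagon1[of b a a'] that by simp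
  have BBA[simp]: "h (b, b', a) = \<one>\<^sub>M" if "a \<in> A" "b \<in> D" "b' \<in> D" for a b b'
    using hexagon2[of b b' a] that by simp
  have AAy[simp]: "h (a, a', y) = \<one>\<^sub>M" if t: "a \<in> A" "a' \<in> A" "y \<in> carrier G" for a a' y
  proof -
    obtain a'' b where y: "y = a'' \<otimes> b" "a'' \<in> A" "b \<in> D" using AB t by blast
    show ?thesis using pentagon[of a a' a'' b] t y by simp
  qed
  have Ayz[simp]: "h (a, y, z) = \<one>\<^sub>M" if t: "a \<in> A" "y \<in> carrier G" "z \<in> carrier G" for a y z
  proof -
    obtain a' b where y: "y = a' \<otimes> b" "a' \<in> A" "b \<in> D" using AB t by blast
    show ?thesis using pentagon[of a a' b z] t y by simp
  qed
  \<comment> \<open>From here on \<open>h\<close> ignores the \<open>A\<close>-component of its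
    first argument. \<open>Baby\<close> gives the same for the second argument once the first lies
    in \<open>D\<close>, so only the values \<open>h (b, b', y)\<close> treated in
    \<open>BBy\<close> remain.\<close>
  have ABcancel: "h (a \<otimes> b, y, z) = h (b, y, z)"
    if t: "a \<in> A" "b \<in> D" "y \<in> carrier G" "z \<in> carrier G" for a b y z
    using pentagon[of a b y z] t by simp
  have BAy[simp]: "h (b, a, y) = \<one>\<^sub>M" if t: "b \<in> D" "a \<in> A" "y \<in> carrier G" for a b y
  proof -
    obtain a' b' where y: "y = a' \<otimes> b'" "a' \<in> A" "b' \<in> D" using AB t by blast
    show ?thesis using pentagon[of b a a' b'] ABcancel[of a b a' b'] G.m_comm[of b a] t y by simp
  qed
  have Baby: "h (b, a \<otimes> b', z) = h (b, b', z)"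
    if t: "b \<in> D" "a \<in> A" "b' \<in> D" "z \<in> carrier G" for b a b' z
    using pentagon[of b a b' z] ABcancel[of a b b' z] G.m_comm[of b a] t by simp
  have BBy[simp]: "h (b, b', y) = \<one>\<^sub>M" if t: "b \<in> D" "b' \<in> D" "y \<in> carrier G" for b b' y
  proof -
    obtain a b'' where y: "y = a \<otimes> b''" "a \<in> A" "b'' \<in> D" using AB t by blast
    show ?thesis using pentagon[of b b' a b''] Baby[of b a b' b''] G.m_comm[of b' a] t y by simp
  qed
  have h[simp]: "h (x, y, z) = \<one>\<^sub>M" if t: "x \<in> carrier G" "y \<in> carrier G" "z \<in> carrier G" for x y z
  proof -
    obtain a b where x: "x = a \<otimes> b" "a \<in> A" "b \<in> D" using AB t by blast
    obtain a' b' where y: "y = a' \<otimes> b'" "a' \<in> A" "b' \<in> D" using AB t by blast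
    show ?thesis using ABcancel[of a b y z] Baby[of b a' b' z] t x y by simp
  qed
  then show "x \<in> carrier G \<Longrightarrow> y \<in> carrier G \<Longrightarrow> z \<in> carrier G \<Longrightarrow> h (x, y, z) = \<one>\<^sub>M" .
  show "c (x, y) = \<one>\<^sub>M" if t: "x \<in> carrier G" "y \<in> carrier G"
  proof -
    obtain a b where x: "x = a \<otimes> b" "a \<in> A" "b \<in> D" using AB t by blast
    obtain a' b' where y: "y = a' \<otimes> b'" "a' \<in> A" "b' \<in> D" using AB t by blast
    show ?thesis using x y by (simp add: c_mult_left c_mult_right)
  qed
qed

section \<open>Direct sums\<close>

text \<open>A direct sum is encoded by its two projections, taken as endomorphisms of
  \<open>G\<close>. The summands are their images, so no product type is needed.\<close>

locale split_pair = abelian_pair +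
  fixes p r :: "'a \<Rightarrow> 'a"
  assumes p_hom: "p \<in> hom G G" and r_hom: "r \<in> hom G G"
    and p_r_decomp: "x \<in> carrier G \<Longrightarrow> p x \<otimes> r x = x"
    and p_r [simp]: "x \<in> carrier G \<Longrightarrow> p (r x) = \<one>"
    and r_p [simp]: "x \<in> carrier G \<Longrightarrow> r (p x) = \<one>"
begin

lemma p_closed [simp]: "x \<in> carrier G \<Longrightarrow> p x \<in> carrier G"
  and r_closed [simp]: "x \<in> carrier G \<Longrightarrow> r x \<in> carrier G"
  and p_mult [simp]: "x \<in> carrier G \<Longrightarrow> y \<in> carrier G \<Longrightarrow> p (x \<otimes> y) = p x \<otimes> p y"
  and r_mult [simp]: "x \<in> carrier G \<Longrightarrow> y \<in> carrier G \<Longrightarrow> r (x \<otimes> y) = r x \<otimes> r y"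
  using p_hom r_hom by (auto simp: hom_def)

lemma p_p [simp]: "x \<in> carrier G \<Longrightarrow> p (p x) = p x"
  using arg_cong[OF p_r_decomp, of x p] by simp

lemma r_r [simp]: "x \<in> carrier G \<Longrightarrow> r (r x) = r x"
  using arg_cong[OF p_r_decomp, of x r] by simp

lemma p_one [simp]: "p \<one> = \<one>" and r_one [simp]: "r \<one> = \<one>"
  using hom_one[OF p_hom] hom_one[OF r_hom] G.group_axioms by auto

text \<open>
  For \<open>x = a + b\<close> and \<open>y = a' + b'\<close> the cochain \<open>k\<close> below is the interchange isomorphism
  \<open>(a + b) + (a' + b') \<rightarrow> (a + a') + (b + b')\<close>, composed of four associators and one braiding.
\<close>

lemma coboundary_if_trivial_on_factors:
  assumes "traceless_cocycle G M h c"
    and hp: "\<And>x y z. x \<in> carrier G \<Longrightarrow> y \<in> carrier G \<Longrightarrow> z \<in> carrier G \<Longrightarrow> h (p x, p y, p z) = \<one>\<^sub>M"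
    and hr: "\<And>x y z. x \<in> carrier G \<Longrightarrow> y \<in> carrier G \<Longrightarrow> z \<in> carrier G \<Longrightarrow> h (r x, r y, r z) = \<one>\<^sub>M"
    and cp: "\<And>x y. x \<in> carrier G \<Longrightarrow> y \<in> carrier G \<Longrightarrow> c (p x, p y) = \<one>\<^sub>M"
    and cr: "\<And>x y. x \<in> carrier G \<Longrightarrow> y \<in> carrier G \<Longrightarrow> c (r x, r y) = \<one>\<^sub>M"
  shows "(h, c) \<in> B"
proof -
  interpret traceless_cocycle G M h c by (rule assms(1))
  define k where "k = (\<lambda>(x, y). (c (r x, p y))\<inverse> \<bullet> h (r x, p y, r y) \<bullet> (h (p y, r x, r y))\<inverse>
    \<bullet> h (p x, p y, r x \<otimes> r y) \<bullet> (h (p x, r x, y))\<inverse>)"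
  have k: "k (x, y) \<in> carrier M" if "x \<in> carrier G" "y \<in> carrier G" for x y
    using that by (simp add: k_def)
  obtain h' c' where Z': "(h', c') \<in> Z"
    and h': "\<forall>x\<in>carrier G. \<forall>y\<in>carrier G. \<forall>z\<in>carrier G.
      h' (x, y, z) = h (x, y, z) \<bullet> (k (y, z))\<inverse> \<bullet> k (x \<otimes> y, z) \<bullet> (k (x, y \<otimes> z))\<inverse> \<bullet> k (x, y)"
    and c': "\<forall>x\<in>carrier G. \<forall>y\<in>carrier G. c' (x, y) = c (x, y) \<bullet> (k (y, x))\<inverse> \<bullet> k (x, y)"
    and B': "(h', c') \<in> B \<longrightarrow> (h, c) \<in> B"
    using cohomologous[where k = k, OF cocycle k] .
  interpret C': two_abelian_cocycle G M h' c' by unfold_locales (rule Z')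
  have tr': "c' (x, x) = \<one>\<^sub>M" if "x \<in> carrier G" for x
    using that k[of x x] by (simp add: c' traceless)
  let ?A = "p ` carrier G" and ?D = "r ` carrier G"
  have kpp: "k (p x, p y) = \<one>\<^sub>M" and krr: "k (r x, r y) = \<one>\<^sub>M" and kpr: "k (p x, r y) = \<one>\<^sub>M"
    and krp: "k (r x, p y) = (c (r x, p y))\<inverse>"
    if "x \<in> carrier G" "y \<in> carrier G" for x y
    using that by (simp_all add: k_def)
  have kr: "k (r x, y) = (c (r x, p y))\<inverse> \<bullet> h (r x, p y, r y) \<bullet> (h (p y, r x, r y))\<inverse>"
    and kp: "k (p x, y) = h (p x, p y, r y)"
    if "x \<in> carrier G" "y \<in> carrier G" for x y
    using that by (simp_all add: k_def)
  \<comment> \<open>Since \<open>k (p x, r y)\<close> is trivial, this is the vanishing of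
    \<open>h'\<close> at \<open>(p x, r y, z)\<close>, solved for one value of
    \<open>k\<close>.\<close>
  have kprp: "k (p x \<otimes> r y, z) = k (r y, z) \<bullet> k (p x, r y \<otimes> z) \<bullet> (h (p x, r y, z))\<inverse>"
    if "x \<in> carrier G" "y \<in> carrier G" "z \<in> carrier G" for x y z
    using that by (simp add: kr kp) (simp add: k_def)
  have kppr: "k (p x \<otimes> p y, r z) = \<one>\<^sub>M" if "x \<in> carrier G" "y \<in> carrier G" "z \<in> carrier G" for x y z
    using kpr[of "x \<otimes> y" z] that by simp
  have canc: "u \<bullet> v\<inverse> \<bullet> (v \<bullet> w \<bullet> u\<inverse>) \<bullet> w\<inverse> = \<one>\<^sub>M"
    if "u \<in> carrier M" "v \<in> carrier M" "w \<in> carrier M" for u v w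
    using that by algebra
  have pdec: "\<exists>a\<in>?A. \<exists>b\<in>?D. x = a \<otimes> b" if "x \<in> carrier G" for x
    using that p_r_decomp[of x, symmetric] by blast
  have anti: "c' (x, y) \<bullet> c' (y, x) = \<one>\<^sub>M" if "x \<in> carrier G" "y \<in> carrier G" for x y
    using C'.trace_mult[OF that] that by (simp add: tr')
  have hyps: "?A \<subseteq> carrier G" "\<And>x y. x \<in> ?A \<Longrightarrow> y \<in> ?A \<Longrightarrow> x \<otimes> y \<in> ?A"
    "?D \<subseteq> carrier G" "\<And>x y. x \<in> ?D \<Longrightarrow> y \<in> ?D \<Longrightarrow> x \<otimes> y \<in> ?D"
    by (auto simp flip: p_mult r_mult)
  have hA: "\<And>x y z. x \<in> ?A \<Longrightarrow> y \<in> ?A \<Longrightarrow> z \<in> ?A \<Longrightarrow> h' (x, y, z) = \<one>\<^sub>M"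
    by (auto simp: h' hp kpp simp flip: p_mult)
  have hD: "\<And>x y z. x \<in> ?D \<Longrightarrow> y \<in> ?D \<Longrightarrow> z \<in> ?D \<Longrightarrow> h' (x, y, z) = \<one>\<^sub>M"
    by (auto simp: h' hr krr simp flip: r_mult)
  have cA: "\<And>x y. x \<in> ?A \<Longrightarrow> y \<in> ?A \<Longrightarrow> c' (x, y) = \<one>\<^sub>M"
    by (auto simp: c' cp kpp)
  have cD: "\<And>x y. x \<in> ?D \<Longrightarrow> y \<in> ?D \<Longrightarrow> c' (x, y) = \<one>\<^sub>M"
    by (auto simp: c' cr krr)
  have ADy: "\<And>a b y. a \<in> ?A \<Longrightarrow> b \<in> ?D \<Longrightarrow> y \<in> carrier G \<Longrightarrow> h' (a, b, y) = \<one>\<^sub>M"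
    by (auto simp: h' kpr kprp k intro!: canc)
  have AAD: "\<And>a b y. a \<in> ?A \<Longrightarrow> b \<in> ?A \<Longrightarrow> y \<in> ?D \<Longrightarrow> h' (a, b, y) = \<one>\<^sub>M"
    by (auto simp: h' kpr kp kppr)
  have "h' (r x, p y, r z) = \<one>\<^sub>M" if x: "x \<in> carrier G" "y \<in> carrier G" "z \<in> carrier G" for x y z
  proof -
    have 1: "k (r x \<otimes> p y, r z) = (h (p y, r x, r z))\<inverse>"
      using x by (simp add: k_def)
    have 2: "k (r x, p y \<otimes> r z) = (c (r x, p y))\<inverse> \<bullet> h (r x, p y, r z) \<bullet> (h (p y, r x, r z))\<inverse>"
      using x by (simp add: k_def)
    have "h (p y, r x, r z) \<in> carrier M" "h (r x, p y, r z) \<in> carrier M" "c (r x, p y) \<in> carrier M"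
      using x by simp_all
    \<comment> \<open>The factor \<open>\<one>\<^sub>M\<inverse>\<close> is the inverse of
      \<open>k (p y, r z)\<close>. It is left unsimplified so that the product has the shape of the
      expanded \<open>h'\<close>.\<close>
    then have "h (r x, p y, r z) \<bullet> \<one>\<^sub>M\<inverse> \<bullet> (h (p y, r x, r z))\<inverse>
       \<bullet> ((c (r x, p y))\<inverse> \<bullet> h (r x, p y, r z) \<bullet> (h (p y, r x, r z))\<inverse>)\<inverse> \<bullet> (c (r x, p y))\<inverse> = \<one>\<^sub>M"
      by algebra
    then show ?thesis using x by (simp add: h' 1 2 kpr krp del: M.inv_one)
  qed
  then have DAD: "\<And>a b y. a \<in> ?D \<Longrightarrow> b \<in> ?A \<Longrightarrow> y \<in> ?D \<Longrightarrow> h' (a, b, y) = \<one>\<^sub>M"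
    by auto
  \<comment> \<open>This is the purpose of the braiding factor in \<open>k\<close>: on these
    arguments \<open>k (x, y)\<close> is the inverse of \<open>c (x, y)\<close>, while
    \<open>k (y, x)\<close> is trivial.\<close>
  have cDA: "\<And>x y. x \<in> ?D \<Longrightarrow> y \<in> ?A \<Longrightarrow> c' (x, y) = \<one>\<^sub>M"
    by (auto simp: c' kpr krp)
  note all = C'.trivial_if_trivial_on_summands[of ?A ?D, OF hyps pdec anti hA hD cA cD ADy AAD DAD cDA]
  have "(h', c') \<in> B"
    by (rule coboundaryI[OF Z', where k = "\<lambda>_. \<one>\<^sub>M"]) (simp_all add: all)
  with B' show ?thesis by blast
qed

lemma coboundary_if_coboundary_on_factors:
  assumes "traceless_cocycle G M h c"
    and p: "pullback G p (h, c) \<in> B" and r: "pullback G r (h, c) \<in> B"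
  shows "(h, c) \<in> B"
proof -
  interpret traceless_cocycle G M h c by (rule assms(1))
  from p obtain k where k: "k \<in> carrier (cochain_group2 G M)" "pullback G p (h, c) = (coboundary2 G M k, commutator2 G M k)"
    by (auto simp: two_abelian_coboundaries3_def)
  from r obtain l where l: "l \<in> carrier (cochain_group2 G M)" "pullback G r (h, c) = (coboundary2 G M l, commutator2 G M l)"
    by (auto simp: two_abelian_coboundaries3_def)
  have kc [simp]: "k (x, y) \<in> carrier M" "l (x, y) \<in> carrier M" if "x \<in> carrier G" "y \<in> carrier G" for x y
    using k(1) l(1) that by (auto simp: cochain_group2_def)
  have hk: "h (p x, p y, p z) = k (y, z) \<bullet> (k (x \<otimes> y, z))\<inverse> \<bullet> k (x, y \<otimes> z) \<bullet> (k (x, y))\<inverse>"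
    if "x \<in> carrier G" "y \<in> carrier G" "z \<in> carrier G" for x y z
    using fun_cong[OF arg_cong[OF k(2), of fst], of "(x, y, z)"] that by (simp add: pullback_def coboundary2_def)
  have hl: "h (r x, r y, r z) = l (y, z) \<bullet> (l (x \<otimes> y, z))\<inverse> \<bullet> l (x, y \<otimes> z) \<bullet> (l (x, y))\<inverse>"
    if "x \<in> carrier G" "y \<in> carrier G" "z \<in> carrier G" for x y z
    using fun_cong[OF arg_cong[OF l(2), of fst], of "(x, y, z)"] that by (simp add: pullback_def coboundary2_def)
  have ck: "c (p x, p y) = k (y, x) \<bullet> (k (x, y))\<inverse>" if "x \<in> carrier G" "y \<in> carrier G" for x y
    using fun_cong[OF arg_cong[OF k(2), of snd], of "(x, y)"] that by (simp add: pullback_def commutator2_def)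
  have cl: "c (r x, r y) = l (y, x) \<bullet> (l (x, y))\<inverse>" if "x \<in> carrier G" "y \<in> carrier G" for x y
    using fun_cong[OF arg_cong[OF l(2), of snd], of "(x, y)"] that by (simp add: pullback_def commutator2_def)
  obtain h' c' where Z': "(h', c') \<in> Z"
    and h': "\<forall>x\<in>carrier G. \<forall>y\<in>carrier G. \<forall>z\<in>carrier G.
      h' (x, y, z) = h (x, y, z) \<bullet> (k (y, z) \<bullet> l (y, z))\<inverse> \<bullet> (k (x \<otimes> y, z) \<bullet> l (x \<otimes> y, z))
        \<bullet> (k (x, y \<otimes> z) \<bullet> l (x, y \<otimes> z))\<inverse> \<bullet> (k (x, y) \<bullet> l (x, y))"
    and c': "\<forall>x\<in>carrier G. \<forall>y\<in>carrier G.
      c' (x, y) = c (x, y) \<bullet> (k (y, x) \<bullet> l (y, x))\<inverse> \<bullet> (k (x, y) \<bullet> l (x, y))"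
    and B': "(h', c') \<in> B \<longrightarrow> (h, c) \<in> B"
    using cohomologous[where k = "\<lambda>i. k i \<bullet> l i", OF cocycle] by (metis (no_types, lifting) kc M.m_closed)
  have a4: "u \<bullet> (s \<bullet> s')\<inverse> \<bullet> (t \<bullet> t') \<bullet> (v \<bullet> v')\<inverse> \<bullet> (w \<bullet> w')
     = u \<bullet> (s \<bullet> t\<inverse> \<bullet> v \<bullet> w\<inverse>)\<inverse> \<bullet> (s' \<bullet> t'\<inverse> \<bullet> v' \<bullet> w'\<inverse>)\<inverse>"
    if "u \<in> carrier M" "s \<in> carrier M" "s' \<in> carrier M" "t \<in> carrier M" "t' \<in> carrier M"
      "v \<in> carrier M" "v' \<in> carrier M" "w \<in> carrier M" "w' \<in> carrier M" for u s s' t t' v v' w w'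
    using that by algebra
  have a2: "u \<bullet> (s \<bullet> s')\<inverse> \<bullet> (t \<bullet> t') = u \<bullet> (s \<bullet> t\<inverse>)\<inverse> \<bullet> (s' \<bullet> t'\<inverse>)\<inverse>"
    if "u \<in> carrier M" "s \<in> carrier M" "s' \<in> carrier M" "t \<in> carrier M" "t' \<in> carrier M" for u s s' t t'
    using that by algebra
  \<comment> \<open>The coboundaries of \<open>k\<close> and \<open>l\<close> are the values of the
    cocycle at the projected arguments, so the cocycle is divided by its own pullbacks along
    \<open>p\<close> and \<open>r\<close>.\<close>
  have h'': "h' (x, y, z) = h (x, y, z) \<bullet> (h (p x, p y, p z))\<inverse> \<bullet> (h (r x, r y, r z))\<inverse>"
    if "x \<in> carrier G" "y \<in> carrier G" "z \<in> carrier G" for x y z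
    unfolding hk[OF that] hl[OF that] using that h' by (simp add: a4)
  have c'': "c' (x, y) = c (x, y) \<bullet> (c (p x, p y))\<inverse> \<bullet> (c (r x, r y))\<inverse>"
    if "x \<in> carrier G" "y \<in> carrier G" for x y
    unfolding ck[OF that] cl[OF that] using that c' by (simp add: a2)
  \<comment> \<open>On arguments from one summand, one of the two divisors cancels the value and the
    other sees only units, where a normalized cocycle is trivial.\<close>
  have "(h', c') \<in> B"
  proof (rule coboundary_if_trivial_on_factors)
    show "traceless_cocycle G M h' c'"
      by unfold_locales (use Z' in \<open>simp_all add: h'' c'' traceless\<close>)
  qed (simp_all add: h'' c'')
  with B' show ?thesis by blast
qed

end

section \<open>Cyclic groups\<close>

text \<open>Partial products of \<open>d\<close>, continued to negative integers by solving the
  recursion backwards. The sequences \<open>u\<close> and \<open>v\<close> cover the two half-lines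
  and meet at zero.\<close>

lemma (in group) int_telescope:
  assumes d: "\<And>i::int. d i \<in> carrier G"
  shows "\<exists>s. s 0 = \<one> \<and> (\<forall>i. s i \<in> carrier G) \<and> (\<forall>i. s (i + 1) = s i \<otimes> d i)"
proof -
  define u where "u = rec_nat \<one> (\<lambda>j v. v \<otimes> d (int j))"
  define v where "v = rec_nat \<one> (\<lambda>j v. v \<otimes> inv (d (- int j - 1)))"
  have u: "u 0 = \<one>" "u (Suc j) = u j \<otimes> d (int j)" for j by (simp_all add: u_def)
  have v: "v 0 = \<one>" "v (Suc j) = v j \<otimes> inv (d (- int j - 1))" for j by (simp_all add: v_def)
  have uc: "u j \<in> carrier G" and vc: "v j \<in> carrier G" for j
    by (induction j) (simp_all add: u v d)
  define s where "s i = (if i \<ge> 0 then u (nat i) else v (nat (- i)))" for i :: int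
  have "s (i + 1) = s i \<otimes> d i" for i
  proof (cases "i \<ge> 0")
    case True
    then show ?thesis by (simp add: s_def nat_add_distrib u)
  next
    case False
    then have "i = - int (nat (- i - 1)) - 1" by simp
    then obtain j where j: "i = - int j - 1" by blast
    have "s i = v (Suc j)" by (simp add: s_def j nat_add_distrib)
    moreover have "s (i + 1) = v j" by (cases "j = 0") (auto simp: s_def j u v)
    ultimately show ?thesis by (simp add: v vc d j m_assoc)
  qed
  then show ?thesis by (intro exI[of _ s]) (simp add: s_def u uc vc)
qed

locale cyclic_pair = abelian_pair +
  fixes a
  assumes a [simp]: "a \<in> carrier G" and generate_a: "carrier G = generate G {a}"
begin

text \<open>
  The order is \<open>0\<close> for an infinite cyclic group; since \<open>i mod 0 = i\<close>, finite and infinite cyclic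
  groups need no separate treatment.
\<close>

abbreviation "n \<equiv> int (G.ord a)"

text \<open>Reduction modulo \<open>n\<close> makes the value independent of the exponent chosen by
  \<open>SOME\<close>: it is the least nonnegative exponent if \<open>n > 0\<close> and the unique
  one if \<open>n = 0\<close>.\<close>

definition idx :: "'a \<Rightarrow> int" where "idx x = (SOME i. x = a [^] i) mod n"

lemma pow_eq_iff: "a [^] (i::int) = a [^] j \<longleftrightarrow> i mod n = j mod n"
  by (metis G.int_pow_eq a mod_eq_dvd_iff)

lemma pow_idx: "x \<in> carrier G \<Longrightarrow> a [^] idx x = x"
proof -
  assume "x \<in> carrier G"
  then obtain i :: int where "x = a [^] i"
    using generate_a G.generate_pow[OF a] by auto
  then have "x = a [^] (SOME i. x = a [^] (i::int))"
    by (rule someI)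
  then show ?thesis
    unfolding idx_def using pow_eq_iff by (metis mod_mod_trivial)
qed

lemma idx_pow: "idx (a [^] (i::int)) = i mod n"
proof -
  have "a [^] idx (a [^] i) = a [^] i" by (rule pow_idx) simp
  then show ?thesis unfolding pow_eq_iff by (simp add: idx_def)
qed

lemma idx_mult: "x \<in> carrier G \<Longrightarrow> y \<in> carrier G \<Longrightarrow> idx (x \<otimes> y) = (idx x + idx y) mod n"
  by (metis G.int_pow_mult a idx_pow pow_idx)

text \<open>The step is an equivalence so that negative powers of \<open>a\<close> are reached as
  well.\<close>

lemma cyclic_induct:
  assumes "P \<one>" and "\<And>x. x \<in> carrier G \<Longrightarrow> P (a \<otimes> x) \<longleftrightarrow> P x" and "x \<in> carrier G"
  shows "P x"
proof -
  have succ: "P (a [^] (i + 1)) \<longleftrightarrow> P (a [^] i)" for i :: int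
    using assms(2)[of "a [^] i"] by (simp add: G.int_pow_mult G.m_comm)
  have "P (a [^] i)" for i :: int
    by (induction i rule: int_induct[where k = 0])
       (use assms(1) succ in \<open>simp_all, metis diff_add_cancel\<close>)
  then show ?thesis by (metis pow_idx assms(3))
qed

text \<open>All values are powers of \<open>q a\<close>, so each cocycle identity becomes a
  congruence of exponents modulo the order of \<open>q a\<close>. The defects are multiples of
  \<open>n * n\<close> or of \<open>2 * n\<close>, and both annihilate \<open>q a\<close>.\<close>

lemma cocycle_of_quadratic_form:
  assumes "q \<in> quadratic_forms G M"
  shows "\<exists>h c. (h, c) \<in> Z \<and> (\<forall>x\<in>carrier G. c (x, x) = q x)"
proof -
  interpret quadratic_form G M q by unfold_locales (rule assms)
  define w where "w = q a"
  have w [simp]: "w \<in> carrier M" by (simp add: w_def)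
  have an: "a [^] n = \<one>" by (simp add: G.int_pow_eq_id)
  \<comment> \<open>Evaluate \<open>q (a [^] n)\<close> and \<open>b (a [^] n) a\<close>: both are
    trivial because \<open>a [^] n\<close> is the unit.\<close>
  have "w [^]\<^bsub>M\<^esub> (n * n) = \<one>\<^sub>M" "w [^]\<^bsub>M\<^esub> (2 * n) = \<one>\<^sub>M"
    using q_int_pow[OF a, of n] b_int_pow_self[OF a, of n] by (simp_all add: an w_def)
  then have ord: "int (M.ord w) dvd n * n" "int (M.ord w) dvd 2 * n"
    by (simp_all only: M.int_pow_eq_id[OF w])
  define carry where "carry y z = idx y + idx z - idx (y \<otimes> z)" for y z
  define h where "h = (\<lambda>(x, y, z). w [^]\<^bsub>M\<^esub> (idx x * carry y z))"
  define c where "c = (\<lambda>(x, y). w [^]\<^bsub>M\<^esub> (idx x * idx y))"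
  have carry: "n dvd carry x y" if "x \<in> carrier G" "y \<in> carrier G" for x y
    using that by (simp add: carry_def idx_mult minus_mod_eq_mult_div)
  have comm: "carry x y = carry y x" if "x \<in> carrier G" "y \<in> carrier G" for x y
    using that by (simp add: carry_def G.m_comm)
  have idx_m: "idx (x \<otimes> y) = idx x + idx y - carry x y" for x y by (simp add: carry_def)
  \<comment> \<open>\<open>carry\<close> is the symmetric 2-cocycle measuring how far
    \<open>idx\<close> is from additive.\<close>
  have assoc: "carry x y + carry (x \<otimes> y) z = carry x (y \<otimes> z) + carry y z"
    if "x \<in> carrier G" "y \<in> carrier G" "z \<in> carrier G" for x y z
    using that by (simp add: carry_def G.m_assoc)
  have "(restrict h (carrier G \<times> carrier G \<times> carrier G), restrict c (carrier G \<times> carrier G)) \<in> Z"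
  proof (rule cocycleI)
    fix x y z v assume x: "x \<in> carrier G" "y \<in> carrier G" "z \<in> carrier G" "v \<in> carrier G"
    \<comment> \<open>The exponents in the pentagon differ by a product of two carries, hence by a
      multiple of \<open>n * n\<close>.\<close>
    have "(idx (x \<otimes> y) * carry z v + idx x * carry y (z \<otimes> v))
        - (idx x * carry y z + idx x * carry (y \<otimes> z) v + idx y * carry z v)
      = idx x * (carry y (z \<otimes> v) + carry z v - (carry y z + carry (y \<otimes> z) v)) - carry x y * carry z v"
      by (simp add: idx_m algebra_simps)
    also have "\<dots> = - (carry x y * carry z v)"
      using assoc[of y z v] x by simp
    finally have "int (M.ord w) dvd (idx (x \<otimes> y) * carry z v + idx x * carry y (z \<otimes> v))
        - (idx x * carry y z + idx x * carry (y \<otimes> z) v + idx y * carry z v)"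
      using ord(1) carry[OF x(1,2)] carry[OF x(3,4)] by (metis dvd_minus_iff dvd_trans mult_dvd_mono)
    then show "h (x, y, z) \<bullet> h (x, y \<otimes> z, v) \<bullet> h (y, z, v) = h (x \<otimes> y, z, v) \<bullet> h (x, y, z \<otimes> v)"
      by (simp add: h_def M.int_pow_eq flip: M.int_pow_mult)
  next
    fix x y z assume x: "x \<in> carrier G" "y \<in> carrier G" "z \<in> carrier G"
    \<comment> \<open>The exponents in the first hexagon agree as integers. In the second they
      differ by twice a multiple of one carry, which is where \<open>2 * n\<close> is used.\<close>
    have "idx y * carry z x + idx x * idx (y \<otimes> z) + idx x * carry y z
      = idx x * idx z + idx y * carry x z + idx x * idx y"
      using x comm[of z x] by (simp add: idx_m algebra_simps)
    then show "h (y, z, x) \<bullet> c (x, y \<otimes> z) \<bullet> h (x, y, z) = c (x, z) \<bullet> h (y, x, z) \<bullet> c (x, y)"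
      by (simp add: h_def c_def flip: M.int_pow_mult)
    have "idx x * idx z - idx x * carry z y + idx y * idx z
      - (idx (x \<otimes> y) * idx z - idx z * carry x y - idx x * carry y z) = 2 * (idx z * carry x y)"
      using x comm[of z y] by (simp add: idx_m algebra_simps)
    moreover have "int (M.ord w) dvd 2 * (idx z * carry x y)"
      using ord(2) carry[OF x(1,2)] by (metis dvd_mult dvd_trans mult.left_commute mult_dvd_mono dvd_refl)
    ultimately have "int (M.ord w) dvd idx x * idx z - idx x * carry z y + idx y * idx z
      - (idx (x \<otimes> y) * idx z - idx z * carry x y - idx x * carry y z)"
      by (simp only:)
    then show "(h (z, x, y))\<inverse> \<bullet> c (x \<otimes> y, z) \<bullet> (h (x, y, z))\<inverse> = c (x, z) \<bullet> (h (x, z, y))\<inverse> \<bullet> c (y, z)"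
      by (simp add: h_def c_def M.int_pow_eq flip: M.int_pow_mult M.int_pow_neg)
  qed (simp_all add: h_def c_def)
  moreover have "c (x, x) = q x" if "x \<in> carrier G" for x
    using q_int_pow[OF a, of "idx x"] that by (simp add: c_def w_def pow_idx)
  ultimately show ?thesis by (intro exI conjI) auto
qed


text \<open>The index wraps around only at \<open>inv a\<close>, whose index is
  \<open>n - 1\<close>; in the infinite case it never does.\<close>

lemma idx_succ:
  assumes x: "x \<in> carrier G" and "n = 0 \<or> x \<noteq> inv a"
  shows "idx (a \<otimes> x) = idx x + 1"
proof (cases "n = 0")
  case True
  then show ?thesis using x idx_pow[of 1] by (simp add: idx_mult)
next
  case False
  then have n: "n > 0" by simp
  have m: "idx x mod n = idx x" using x by (metis idx_pow pow_idx)
  then have r: "0 \<le> idx x" "idx x < n" using n by (metis pos_mod_sign, metis pos_mod_bound)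
  have "idx x + 1 \<noteq> n"
  proof
    assume "idx x + 1 = n"
    then have "a [^] (idx x + 1) = \<one>" by (simp add: G.int_pow_eq_id)
    then have "x \<otimes> a = \<one>" using x by (simp add: G.int_pow_mult pow_idx)
    then have "x = inv a" using x by (metis G.inv_equality a)
    with assms(2) False show False by simp
  qed
  moreover have "idx (a \<otimes> x) = (idx x + 1) mod n"
    by (metis G.int_pow_mult G.int_pow_1 G.m_comm a idx_pow pow_idx x)
  ultimately show ?thesis using r by simp
qed

text \<open>After the correction by \<open>k\<close>, the only possibly nontrivial values of
  \<open>h'\<close> with first argument \<open>a\<close> are \<open>h' (a, inv a, z)\<close>.
  Running once around the cycle with the first hexagon settles \<open>z = a\<close>, and a pentagon
  shows that the value does not depend on \<open>z\<close>. Induction along the powers of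
  \<open>a\<close> then kills \<open>h'\<close> and \<open>c'\<close>.\<close>

lemma coboundary_if_traceless_cyclic:
  assumes "traceless_cocycle G M h c"
  shows "(h, c) \<in> B"
proof -
  interpret traceless_cocycle G M h c by (rule assms)
  \<comment> \<open>For fixed \<open>y\<close> the sequence telescopes
    \<open>h (a, a [^] i, y)\<close>. Read at \<open>idx x\<close>, it yields a cochain whose step
    from \<open>x\<close> to \<open>a \<otimes> x\<close> cancels \<open>h (a, x, y)\<close>, except
    at the wrap-around.\<close>
  have "\<exists>s. s 0 = \<one>\<^sub>M \<and> (\<forall>i. s i \<in> carrier M) \<and> (\<forall>i. s (i + 1) = s i \<bullet> (h (a, a [^] (i::int), y))\<inverse>)"
    if y: "y \<in> carrier G" for y
    by (rule M.int_telescope) (use y in simp)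
  then obtain s where s: "s y 0 = \<one>\<^sub>M" "s y i \<in> carrier M"
    "s y (i + 1) = s y i \<bullet> (h (a, a [^] i, y))\<inverse>" if "y \<in> carrier G" for y and i :: int
    by metis
  define k where "k = (\<lambda>(x, y). s y (idx x))"
  have k [simp]: "k (x, y) \<in> carrier M" if "x \<in> carrier G" "y \<in> carrier G" for x y
    using that by (simp add: k_def s)
  have idx_one: "idx \<one> = 0" using idx_pow[of 0] by simp
  have k1 [simp]: "k (\<one>, y) = \<one>\<^sub>M" if "y \<in> carrier G" for y
    using that by (simp add: k_def idx_one s)
  define good where "good x \<longleftrightarrow> x \<in> carrier G \<and> (n = 0 \<or> x \<noteq> inv a)" for x
  have good_closed: "x \<in> carrier G" if "good x" for x using that by (simp add: good_def)
  have k_succ: "k (a \<otimes> x, y) = k (x, y) \<bullet> (h (a, x, y))\<inverse>" if "good x" "y \<in> carrier G" for x y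
    using that s(3)[of y "idx x"] idx_succ[of x] by (simp add: k_def good_def pow_idx)
  \<comment> \<open>If the unit is not good then \<open>a\<close> itself is the unit, and the facts
    about the unit argument take over.\<close>
  have good_one: "good \<one> \<or> a = \<one>" unfolding good_def by (metis G.inv_inv G.inv_one G.one_closed a)
  have ka [simp]: "k (a, y) = \<one>\<^sub>M" if "y \<in> carrier G" for y
    using good_one k_succ[of \<one> y] that by auto
  obtain h' c' where Z': "(h', c') \<in> Z"
    and h': "\<forall>x\<in>carrier G. \<forall>y\<in>carrier G. \<forall>z\<in>carrier G.
      h' (x, y, z) = h (x, y, z) \<bullet> (k (y, z))\<inverse> \<bullet> k (x \<otimes> y, z) \<bullet> (k (x, y \<otimes> z))\<inverse> \<bullet> k (x, y)"
    and c': "\<forall>x\<in>carrier G. \<forall>y\<in>carrier G. c' (x, y) = c (x, y) \<bullet> (k (y, x))\<inverse> \<bullet> k (x, y)"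
    and B': "(h', c') \<in> B \<longrightarrow> (h, c) \<in> B"
    using cohomologous[where k = k, OF cocycle k] .
  interpret C': two_abelian_cocycle G M h' c' by unfold_locales (rule Z')
  have h'_good [simp]: "h' (a, x, y) = \<one>\<^sub>M" if "good x" "y \<in> carrier G" for x y
  proof -
    have "u \<bullet> v\<inverse> \<bullet> (v \<bullet> u\<inverse>) \<bullet> \<one>\<^sub>M \<bullet> \<one>\<^sub>M = \<one>\<^sub>M" if "u \<in> carrier M" "v \<in> carrier M" for u v
      using that by algebra
    then show ?thesis using that good_closed[of x] by (simp add: h' k_succ)
  qed
  have h'_one [simp]: "h' (\<one>, x, y) = \<one>\<^sub>M" if "x \<in> carrier G" "y \<in> carrier G" for x y
    using that by (simp add: h')
  have h'_a_one [simp]: "h' (a, \<one>, y) = \<one>\<^sub>M" if "y \<in> carrier G" for y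
    using good_one that by auto
  have h'_succ: "h' (a \<otimes> x, y, z) = h' (x, y, z) \<bullet> h' (a, x \<otimes> y, z)"
    if "good x" "y \<in> carrier G" "z \<in> carrier G" for x y z
    using C'.pentagon[of a x y z] that good_closed[of x] by (simp add: M.m_comm)
  have c'_aa: "c' (a, a) = \<one>\<^sub>M" by (simp add: c' traceless)
  have c'_a_one: "c' (a, \<one>) = \<one>\<^sub>M"
    using C'.c_mult_right[of a \<one> \<one>] by simp
  have c'_step: "c' (a, x \<otimes> a) \<bullet> h' (a, x, a) = c' (a, x)" if x: "x \<in> carrier G" for x
    using C'.hexagon1[of a x a] x by (simp add: c'_aa M.m_assoc)
  have u: "h' (a, inv a, z) = \<one>\<^sub>M" if z: "z \<in> carrier G" for z
  proof (cases "n = 0 \<or> a = \<one>")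
    case True
    then show ?thesis using z h'_good[of "inv a" z] h'_one[of \<one> z] by (auto simp: good_def simp del: h'_good)
  next
    case False
    then have n2: "n \<ge> 2" using G.ord_eq_1[OF a] by linarith
    have good_pow: "good (a [^] i)" if "Suc i < G.ord a" for i :: nat
    proof -
      have "a [^] i \<noteq> inv a"
      proof
        assume "a [^] i = inv a"
        then have "a [^] Suc i = \<one>" by simp
        then show False using that by (metis G.pow_eq_id a dvd_imp_le not_le zero_less_Suc)
      qed
      then show ?thesis by (simp add: good_def)
    qed
    \<comment> \<open>With order \<open>m + 2\<close>, the element \<open>inv a\<close> is the power
      \<open>m + 1\<close>, and the powers from \<open>0\<close> to \<open>m\<close> are
      good.\<close>
    have "G.ord a = Suc (Suc (G.ord a - 2))" using n2 by simp
    then obtain m where m: "G.ord a = Suc (Suc m)" by blast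
    have inv_a: "inv a = a [^] Suc m"
      using G.pow_ord_eq_1[OF a] unfolding m by (metis G.inv_equality G.nat_pow_Suc G.nat_pow_closed G.m_comm a)
    have "c' (a, a [^] i) = \<one>\<^sub>M" if "i < G.ord a" for i :: nat
      using that
    proof (induction i)
      case (Suc i)
      then show ?case using c'_step[of "a [^] i"] good_pow[of i] by simp
    qed (simp add: c'_a_one)
    from this[of "Suc m"] have "c' (a, inv a) = \<one>\<^sub>M"
      by (simp only: inv_a m lessI)
    \<comment> \<open>The step from \<open>inv a\<close> to the unit closes the cycle:
      \<open>c' (a, -)\<close> is trivial at both ends, so the associator between them is trivial
      too.\<close>
    then have ua: "h' (a, inv a, a) = \<one>\<^sub>M"
      using c'_step[of "inv a"] by (simp add: c'_a_one)
    have h'_pow: "h' (a [^] i, a, z) = \<one>\<^sub>M" if "i \<le> m" "z \<in> carrier G" for i :: nat and z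
      using that
    proof (induction i)
      case (Suc i)
      then show ?case
        using h'_succ[of "a [^] i" a z] good_pow[of i] good_pow[of "Suc i"] m by (simp add: G.m_comm)
    qed simp
    have h'_inv: "h' (inv a, a, z) = h' (a, inv a, z)" if "z \<in> carrier G" for z
      using h'_succ[of "a [^] m" a z] h'_pow[of m z] good_pow[of m] m that by (simp add: inv_a G.m_comm)
    \<comment> \<open>The pentagon gives \<open>h' (inv a, a, z)\<close> on one side and
      \<open>h' (a, inv a, a \<otimes> z)\<close> on the other; \<open>h'_inv\<close> turns the
      former into \<open>h' (a, inv a, z)\<close>.\<close>
    have shift: "h' (a, inv a, a \<otimes> z) = h' (a, inv a, z)" if "z \<in> carrier G" for z
      using C'.pentagon[of a "inv a" a z] that by (simp add: ua h'_inv)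
    show ?thesis
      by (rule cyclic_induct[OF _ _ z]) (use shift[of \<one>] ua shift in simp_all)
  qed
  have h'_a: "h' (a, x, y) = \<one>\<^sub>M" if "x \<in> carrier G" "y \<in> carrier G" for x y
    using that u h'_good[of x y] by (cases "x = inv a") (auto simp: good_def)
  have h'_shift: "h' (a \<otimes> x, y, z) = h' (x, y, z)"
    if "x \<in> carrier G" "y \<in> carrier G" "z \<in> carrier G" for x y z
    using C'.pentagon[of a x y z] that by (simp add: h'_a)
  have h'_triv: "h' (x, y, z) = \<one>\<^sub>M" if "x \<in> carrier G" "y \<in> carrier G" "z \<in> carrier G" for x y z
    by (rule cyclic_induct[OF _ _ that(1)]) (use that h'_shift in simp_all)
  have c'_one: "c' (\<one>, y) = \<one>\<^sub>M" "c' (y, \<one>) = \<one>\<^sub>M" if "y \<in> carrier G" for y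
    using C'.c_mult_left[of \<one> \<one> y] C'.c_mult_right[of y \<one> \<one>] that by (simp_all add: h'_triv)
  have c'_a: "c' (a, y) = \<one>\<^sub>M" if "y \<in> carrier G" for y
    by (rule cyclic_induct[OF _ _ that]) (simp_all add: c'_one c'_aa h'_triv C'.c_mult_right)
  have c'_triv: "c' (x, y) = \<one>\<^sub>M" if "x \<in> carrier G" "y \<in> carrier G" for x y
    by (rule cyclic_induct[OF _ _ that(1)]) (use that in \<open>simp_all add: c'_one c'_a h'_triv C'.c_mult_left\<close>)
  have "(h', c') \<in> B"
    by (rule coboundaryI[OF Z', where k = "\<lambda>_. \<one>\<^sub>M"]) (simp_all add: h'_triv c'_triv)
  with B' show ?thesis by blast
qed

end

section \<open>Decomposition of finitely generated abelian groups\<close>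

lemma (in group) generates_if_generators_generated:
  assumes "H \<subseteq> carrier G" and "K \<subseteq> generate G H" and "generate G K = carrier G"
  shows "generate G H = carrier G"
  using generate_subgroup_incl[OF assms(2) generate_is_subgroup[OF assms(1)]] generate_incl[OF assms(1)] assms(3)
  by blast

context comm_group
begin

lemma generate_insertE:
  assumes "x \<in> generate G (insert u T)" and u: "u \<in> carrier G" and T: "T \<subseteq> carrier G"
  obtains l :: int and v where "v \<in> generate G T" and "x = u [^] l \<otimes> v"
proof -
  interpret T: subgroup "generate G T" G by (rule generate_is_subgroup[OF T])
  have "\<exists>l::int. \<exists>v\<in>generate G T. x = u [^] l \<otimes> v"
    using assms(1)
  proof (induction rule: generate.induct)
    case one
    show ?case by (rule exI[of _ 0], rule bexI[of _ \<one>]) (simp_all add: generate.one)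
  next
    case (incl y)
    show ?case
    proof (cases "y = u")
      case True
      then show ?thesis using u by (intro exI[of _ 1] bexI[of _ \<one>]) (simp_all add: generate.one)
    next
      case False
      then have "y \<in> generate G T" using incl by (blast intro: generate.incl)
      then show ?thesis by (intro exI[of _ 0] bexI[of _ y]) simp_all
    qed
  next
    case (inv y)
    show ?case
    proof (cases "y = u")
      case True
      then show ?thesis
        using u by (intro exI[of _ "-1"] bexI[of _ \<one>]) (simp_all add: generate.one int_pow_neg)
    next
      case False
      then have "inv y \<in> generate G T" using inv by (blast intro: generate.inv)
      then show ?thesis by (intro exI[of _ 0] bexI[of _ "inv y"]) simp_all
    qed
  next
    case (eng x y)
    then obtain l m :: int and v w where v: "v \<in> generate G T" "x = u [^] l \<otimes> v"
      and w: "w \<in> generate G T" "y = u [^] m \<otimes> w" by blast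
    have "x \<otimes> y = u [^] (l + m) \<otimes> (v \<otimes> w)"
      using u v w by (simp add: int_pow_mult m_ac)
    then show ?case using v(1) w(1) by blast
  qed
  then show thesis using that by blast
qed

text \<open>
  Among all ways of singling out one generator \<open>a\<close> and leaving at most \<open>m\<close> others \<open>T\<close>, take one where
  the least positive multiple \<open>d\<close> of \<open>a\<close> lying in \<open>\<langle>T\<rangle>\<close> is smallest. Division with remainder against \<open>d\<close>
  allows to change \<open>a\<close> by elements of \<open>\<langle>T\<rangle>\<close>, one generator at a time, until its multiple by \<open>d\<close> vanishes.
\<close>

lemma cyclic_summand:
  assumes S: "finite S" "S \<subseteq> carrier G" "generate G S = carrier G" "card S \<le> Suc m"
  obtains a T where "a \<in> carrier G" "T \<subseteq> carrier G" "finite T" "card T \<le> m"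
    "generate G (insert a T) = carrier G" "\<forall>l::int. a [^] l \<in> generate G T \<longrightarrow> a [^] l = \<one>"
proof -
  define good where "good a T \<longleftrightarrow> a \<in> carrier G \<and> T \<subseteq> carrier G \<and> finite T \<and> card T \<le> m \<and>
    generate G (insert a T) = carrier G" for a T
  \<comment> \<open>The exponent is minimized over all splittings, so that minimality can later be
    applied after another generator has been singled out.\<close>
  define R where "R d \<longleftrightarrow> 0 < d \<and> (\<exists>a T. good a T \<and> a [^] d \<in> generate G T)" for d :: nat
  have "\<exists>a T. good a T"
  proof (cases "S = {}")
    case True
    then have "carrier G = {\<one>}" using S by (simp add: generate_empty)
    then have "good \<one> {}" using generate_one by (simp add: good_def)
    then show ?thesis by blast
  next
    case False
    then obtain a where "a \<in> S" by blast
    then have "good a (S - {a})" using S by (simp add: good_def insert_absorb)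
      (use \<open>a \<in> S\<close> in auto)
    then show ?thesis by blast
  qed
  then obtain a0 T0 where good0: "good a0 T0" by blast
  have R_int: "R (nat l)" if "good a T" "a [^] l \<in> generate G T" "0 < l" for a T and l :: int
  proof -
    have "a [^] nat l = a [^] l" using that(3) by (metis int_pow_int int_nat_eq less_imp_le)
    then show ?thesis using that by (auto simp: R_def)
  qed
  show thesis
  proof (cases "\<exists>d. R d")
    \<comment> \<open>No splitting has a positive power of its generator in the rest, so any
      splitting works and only the exponent zero occurs.\<close>
    case False
    have "l = 0" if l: "a0 [^] l \<in> generate G T0" for l :: int
    proof (rule ccontr)
      assume "l \<noteq> 0"
      moreover have "a0 [^] (- l) \<in> generate G T0"
        using generate_m_inv_closed[OF _ l] good0 by (simp add: good_def int_pow_neg)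
      ultimately show False using R_int[OF good0 l] R_int[OF good0, of "- l"] False by fastforce
    qed
    then have "\<forall>l::int. a0 [^] l \<in> generate G T0 \<longrightarrow> a0 [^] l = \<one>"
      using int_pow_0 by metis
    then show ?thesis using that[of a0 T0] good0 by (simp add: good_def)
  next
    case True
    define d where "d = (LEAST d. R d)"
    have d: "R d" using True unfolding d_def by (metis LeastI)
    have d_min: "\<not> R e" if "e < d" for e using that not_less_Least unfolding d_def by blast
    obtain a1 T where a1: "good a1 T" "a1 [^] d \<in> generate G T" and d0: "0 < d"
      using d by (auto simp: R_def)
    have T: "T \<subseteq> carrier G" "finite T" "card T \<le> m" using a1 by (auto simp: good_def)
    have rem: "r = 0" if "good a V" "a [^] r \<in> generate G V" "0 \<le> r" "r < int d" for a V r
      using R_int[OF that(1,2)] d_min[of "nat r"] that(3,4) by linarith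
    \<comment> \<open>Induction on the set \<open>U\<close> of generators still occurring in
      \<open>a [^] int d\<close>: each round changes \<open>a\<close> so that one of them
      disappears.\<close>
    have "\<exists>a'. good a' T \<and> a' [^] int d = \<one>" if "U \<subseteq> T" "good a T" "a [^] int d \<in> generate G U" for U a
      using finite_subset[OF that(1) T(2)] that
    proof (induction U arbitrary: a rule: finite_induct)
      case empty
      then show ?case by (auto simp: generate_empty)
    next
      case (insert u U)
      have U: "U \<subseteq> carrier G" and u: "u \<in> carrier G" "u \<in> T" and a: "a \<in> carrier G"
        using insert.prems T by (auto simp: good_def)
      obtain l :: int and v where v: "v \<in> generate G U" "a [^] int d = u [^] l \<otimes> v"
        using generate_insertE[OF insert.prems(3) u(1) U] .
      have vc: "v \<in> carrier G" using generate_in_carrier[OF U v(1)] .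
      define q r where "q = l div int d" and "r = l mod int d"
      define b where "b = a \<otimes> u [^] (- q)"
      have b: "b \<in> carrier G" using a u by (simp add: b_def)
      have "b [^] int d = a [^] int d \<otimes> u [^] (- q * int d)"
        using a u by (simp add: b_def int_pow_distrib int_pow_pow)
      also have "\<dots> = u [^] (l + - q * int d) \<otimes> v"
        using u vc unfolding v(2) int_pow_mult[OF u(1)] by (simp add: m_ac)
      also have "l + - q * int d = r" by (simp add: q_def r_def minus_mult_div_eq_mod flip: minus_div_mult_eq_mod)
      finally have bd: "b [^] int d = u [^] r \<otimes> v" .
      have sub: "subgroup (generate G (insert b T)) G"
        by (rule generate_is_subgroup) (use b T in auto)
      have "a = b \<otimes> u [^] q" using a u by (simp add: b_def m_assoc flip: int_pow_mult)
      moreover have "u [^] q \<in> generate G (insert b T)"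
        using subgroup_int_pow_closed[OF sub] u by (blast intro: generate.incl)
      ultimately have "a \<in> generate G (insert b T)"
        by (metis generate.eng generate.incl insertI1)
      then have "insert a T \<subseteq> generate G (insert b T)" by (auto intro: generate.incl)
      then have gen: "generate G (insert b T) = carrier G"
        by (rule generates_if_generators_generated[rotated]) (use insert.prems(2) b T in \<open>auto simp: good_def\<close>)
      then have good_b: "good b T" using insert.prems(2) b by (simp add: good_def)
      \<comment> \<open>The generators \<open>u\<close> and \<open>b\<close> exchange roles:
        \<open>u\<close> is singled out and \<open>b\<close> joins the rest. Then
        \<open>u [^] r\<close> lies in the span of the rest with \<open>0 \<le> r < d\<close>, and
        minimality of \<open>d\<close> forces \<open>r = 0\<close>.\<close>
      let ?V = "insert b (T - {u})"
      have "good u ?V"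
      proof -
        have "insert u ?V = insert b T" using u by auto
        moreover have "card ?V \<le> card T"
          using card_Suc_Diff1[OF T(2) u(2)] card_insert_if[of "T - {u}" b] T(2) by (simp split: if_splits)
        ultimately show ?thesis using u b T gen by (auto simp: good_def)
      qed
      moreover have "u [^] r \<in> generate G ?V"
      proof -
        have V: "?V \<subseteq> carrier G" using b T by auto
        have sV: "subgroup (generate G ?V) G" by (rule generate_is_subgroup[OF V])
        have "b [^] int d \<in> generate G ?V"
          using subgroup_int_pow_closed[OF sV] by (blast intro: generate.incl)
        moreover have "v \<in> generate G ?V"
          using v(1) mono_generate[of U ?V] insert.hyps insert.prems(1) by blast
        moreover have "u [^] r = b [^] int d \<otimes> inv v"
          using bd u vc by (simp add: m_assoc)
        ultimately show ?thesis
          by (metis generate.eng generate_m_inv_closed[OF V])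
      qed
      ultimately have "r = 0" using rem d0 by (simp add: r_def)
      then have "b [^] int d \<in> generate G U" using bd v(1) vc by simp
      then show ?case using insert.IH[OF _ good_b] insert.prems(1) by blast
    qed
    then obtain a where a: "good a T" "a [^] int d = \<one>"
      using a1 by (metis int_pow_int order_refl)
    have ac: "a \<in> carrier G" using a by (simp add: good_def)
    have "\<forall>l::int. a [^] l \<in> generate G T \<longrightarrow> a [^] l = \<one>"
    proof (intro allI impI)
      fix l :: int assume l: "a [^] l \<in> generate G T"
      have "a [^] l = a [^] (int d * (l div int d) + l mod int d)" by simp
      also have "\<dots> = a [^] (l mod int d)"
        using ac a(2) by (simp only: int_pow_mult int_pow_pow[symmetric]) simp
      finally have *: "a [^] l = a [^] (l mod int d)" .
      have "l mod int d = 0" using rem[OF a(1) l[unfolded *]] d0 by simp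
      from *[unfolded this] show "a [^] l = \<one>" by simp
    qed
    then show ?thesis using that[of a T] a(1) by (simp add: good_def)
  qed
qed

text \<open>Chosen components are unique because the intersection is trivial, and uniqueness makes
  them multiplicative. The codomains record the images, as needed for restricting to the
  summands.\<close>

lemma complement_projections:
  assumes A: "subgroup A G" and D: "subgroup D G" and int: "A \<inter> D = {\<one>}"
    and sum: "\<And>x. x \<in> carrier G \<Longrightarrow> \<exists>a\<in>A. \<exists>b\<in>D. x = a \<otimes> b"
  obtains p r where "p \<in> hom G (G\<lparr>carrier := A\<rparr>)" "r \<in> hom G (G\<lparr>carrier := D\<rparr>)"
    "\<forall>x\<in>carrier G. p x \<otimes> r x = x \<and> p (r x) = \<one> \<and> r (p x) = \<one>"
proof -
  interpret A: subgroup A G by (rule A)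
  interpret D: subgroup D G by (rule D)
  have uniq: "a = a' \<and> b = b'" if "a \<in> A" "a' \<in> A" "b \<in> D" "b' \<in> D" "a \<otimes> b = a' \<otimes> b'" for a a' b b'
  proof -
    have "inv a' \<otimes> a = b' \<otimes> inv b"
      using that by (metis A.mem_carrier D.mem_carrier inv_closed inv_solve_left inv_solve_right m_assoc m_closed)
    moreover have "inv a' \<otimes> a \<in> A" "b' \<otimes> inv b \<in> D" using that by simp_all
    ultimately have "inv a' \<otimes> a \<in> A \<inter> D" by simp
    then have "inv a' \<otimes> a = \<one>" using int by simp
    then have "a = a'" using that by (metis A.mem_carrier inv_closed inv_equality inv_inv)
    with that show ?thesis by simp
  qed
  have "\<forall>x\<in>carrier G. \<exists>a b. a \<in> A \<and> b \<in> D \<and> x = a \<otimes> b" using sum by blast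
  then obtain p r where pr: "\<And>x. x \<in> carrier G \<Longrightarrow> p x \<in> A" "\<And>x. x \<in> carrier G \<Longrightarrow> r x \<in> D"
    "\<And>x. x \<in> carrier G \<Longrightarrow> x = p x \<otimes> r x" by metis
  have eq: "p x = a \<and> r x = b" if "a \<in> A" "b \<in> D" "x = a \<otimes> b" for x a b
    using uniq[of "p x" a "r x" b] that pr[of x] by simp
  have "p (x \<otimes> y) = p x \<otimes> p y \<and> r (x \<otimes> y) = r x \<otimes> r y" if x: "x \<in> carrier G" "y \<in> carrier G" for x y
  proof (rule eq)
    have "p x \<in> carrier G" "p y \<in> carrier G" "r x \<in> carrier G" "r y \<in> carrier G"
      using pr(1,2)[OF x(1)] pr(1,2)[OF x(2)] by auto
    then have "(p x \<otimes> r x) \<otimes> (p y \<otimes> r y) = p x \<otimes> p y \<otimes> (r x \<otimes> r y)" by (simp add: m_ac)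
    then show "x \<otimes> y = p x \<otimes> p y \<otimes> (r x \<otimes> r y)" using pr(3) x by metis
  qed (use pr x in simp_all)
  moreover have "p (r x) = \<one>" "r (p x) = \<one>" if "x \<in> carrier G" for x
    using eq[of \<one> "r x" "r x"] eq[of "p x" \<one> "p x"] pr[OF that] by simp_all
  ultimately show thesis
    using pr by (intro that[of p r]) (auto simp: hom_def)
qed

end

section \<open>The trace isomorphism\<close>

text \<open>Induction on a bound for the number of generators, splitting off the cyclic group found
  by \<open>cyclic_summand\<close>. Subgroups are the same structure with a smaller carrier, so
  \<open>P\<close> applies to them at the same type.\<close>

lemma finitely_generated_abelian_induct [consumes 2, case_names cyclic sum]:
  fixes G (structure) and P :: "('g, 'a) monoid_scheme \<Rightarrow> bool"
  assumes "comm_group G" and "finitely_generated_group G"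
    and cyclic: "\<And>G a. comm_group G \<Longrightarrow> a \<in> carrier G \<Longrightarrow> carrier G = generate G {a} \<Longrightarrow> P G"
    and sum: "\<And>G A D p r. comm_group G \<Longrightarrow> subgroup A G \<Longrightarrow> subgroup D G \<Longrightarrow>
      p \<in> hom G (G\<lparr>carrier := A\<rparr>) \<Longrightarrow> r \<in> hom G (G\<lparr>carrier := D\<rparr>) \<Longrightarrow>
      (\<And>x. x \<in> carrier G \<Longrightarrow> p x \<otimes>\<^bsub>G\<^esub> r x = x \<and> p (r x) = \<one>\<^bsub>G\<^esub> \<and> r (p x) = \<one>\<^bsub>G\<^esub>) \<Longrightarrow>
      P (G\<lparr>carrier := A\<rparr>) \<Longrightarrow> P (G\<lparr>carrier := D\<rparr>) \<Longrightarrow> P G"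
  shows "P G"
proof -
  obtain S where S: "finite S" "S \<subseteq> carrier G" "generate G S = carrier G"
    using assms(2) by (auto simp: finitely_generated_group_def)
  have "P G" if "comm_group G" "finite S" "S \<subseteq> carrier G" "generate G S = carrier G" "card S \<le> m"
    for m S and G :: "('g, 'a) monoid_scheme"
    using that
  proof (induction m arbitrary: G S)
    case 0
    interpret G: comm_group G by (rule 0)
    \<comment> \<open>Without generators the group is trivial, hence cyclic with the unit as
      generator.\<close>
    have "carrier G = generate G {}" using 0 by simp
    then have "carrier G = generate G {\<one>\<^bsub>G\<^esub>}"
      unfolding G.generate_empty G.generate_one .
    then show ?case using cyclic[OF 0(1)] by blast
  next
    case (Suc m)
    interpret G: comm_group G by (rule Suc.prems(1))
    obtain a T where a: "a \<in> carrier G" and T: "T \<subseteq> carrier G" "finite T" "card T \<le> m"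
      and gen: "generate G (insert a T) = carrier G"
      and int: "\<forall>l::int. a [^]\<^bsub>G\<^esub> l \<in> generate G T \<longrightarrow> a [^]\<^bsub>G\<^esub> l = \<one>\<^bsub>G\<^esub>"
      using G.cyclic_summand[OF Suc.prems(2-5)] by metis
    let ?A = "generate G {a}" and ?D = "generate G T"
    have A: "subgroup ?A G" and D: "subgroup ?D G"
      using a T by (auto intro!: G.generate_is_subgroup)
    have TD: "T \<subseteq> ?D" by (auto intro: generate.incl)
    have powA: "x \<in> ?A \<longleftrightarrow> (\<exists>l::int. x = a [^]\<^bsub>G\<^esub> l)" for x
      using G.generate_pow[OF a] by auto
    have "?A \<inter> ?D = {\<one>\<^bsub>G\<^esub>}"
      using int powA by (auto intro: generate.one)
    moreover have "\<exists>a\<in>?A. \<exists>b\<in>?D. x = a \<otimes>\<^bsub>G\<^esub> b" if "x \<in> carrier G" for x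
      using G.generate_insertE[of x a T] that gen a T powA by metis
    ultimately obtain p r where pr: "p \<in> hom G (G\<lparr>carrier := ?A\<rparr>)" "r \<in> hom G (G\<lparr>carrier := ?D\<rparr>)"
      "\<forall>x\<in>carrier G. p x \<otimes>\<^bsub>G\<^esub> r x = x \<and> p (r x) = \<one>\<^bsub>G\<^esub> \<and> r (p x) = \<one>\<^bsub>G\<^esub>"
      using G.complement_projections[OF A D] by metis
    have "P (G\<lparr>carrier := ?A\<rparr>)"
      by (rule cyclic[where a = a])
         (simp_all add: subgroup_imp_comm_group[OF Suc.prems(1) A] generate.incl G.generate_consistent[OF _ A])
    moreover have "P (G\<lparr>carrier := ?D\<rparr>)"
      by (rule Suc.IH[OF subgroup_imp_comm_group[OF Suc.prems(1) D] T(2) _ _ T(3)])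
         (simp_all add: G.generate_consistent[OF TD D] TD)
    ultimately show ?case
      using sum[OF Suc.prems(1) A D pr(1,2)] pr(3) by blast
  qed
  then show ?thesis using assms(1) S by blast
qed

text \<open>The identity \<open>q x = q (p x) \<bullet> q (r x) \<bullet> b (p x) (r x)\<close>
  leaves the mixed term to be realized. As a bilinear map, it is a braiding with trivial
  associator.\<close>

lemma (in split_pair) cocycle_of_quadratic_form_sum:
  assumes q: "q \<in> quadratic_forms G M"
    and hc1: "(h1, c1) \<in> Z" "\<And>x. x \<in> carrier G \<Longrightarrow> c1 (x, x) = q (p x)"
    and hc2: "(h2, c2) \<in> Z" "\<And>x. x \<in> carrier G \<Longrightarrow> c2 (x, x) = q (r x)"
  shows "\<exists>h c. (h, c) \<in> Z \<and> (\<forall>x\<in>carrier G. c (x, x) = q x)"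
proof -
  interpret quadratic_form G M q by unfold_locales (rule q)
  define e where "e = (\<lambda>_ :: 'a \<times> 'a \<times> 'a. \<one>\<^sub>M)"
  define \<beta> where "\<beta> = (\<lambda>(x, y). b (p x) (r y))"
  have "(restrict e (carrier G \<times> carrier G \<times> carrier G), restrict \<beta> (carrier G \<times> carrier G)) \<in> Z"
    by (rule cocycleI) (simp_all add: e_def \<beta>_def b_mult_left b_mult_right M.m_comm)
  from mult_cocycle[OF mult_cocycle[OF hc1(1) hc2(1)] this]
  have "(\<lambda>i\<in>carrier G \<times> carrier G \<times> carrier G. h1 i \<bullet> h2 i \<bullet> \<one>\<^sub>M, \<lambda>i\<in>carrier G \<times> carrier G. c1 i \<bullet> c2 i \<bullet> \<beta> i) \<in> Z"
    by (simp add: e_def cong: restrict_cong)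
  moreover have "c1 (x, x) \<bullet> c2 (x, x) \<bullet> \<beta> (x, x) = q x" if "x \<in> carrier G" for x
    using that q_mult[of "p x" "r x"] by (simp add: hc1 hc2 \<beta>_def p_r_decomp)
  ultimately show ?thesis by (intro exI conjI) auto
qed

lemma (in abelian_pair) hom_subgroup_incl:
  "subgroup A G \<Longrightarrow> (\<lambda>x. x) \<in> hom (G\<lparr>carrier := A\<rparr>) G"
  using subgroup.subset by (auto simp: hom_def)

lemma (in abelian_pair) hom_into_subgroup:
  "subgroup A G \<Longrightarrow> f \<in> hom G (G\<lparr>carrier := A\<rparr>) \<Longrightarrow> f \<in> hom G G"
  using subgroup.subset by (fastforce simp: hom_def)

text \<open>Restricting to a summand and pulling back along its projection is pulling back along an
  endomorphism. This carries the induction hypothesis, which concerns the subgroup, over to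
  \<open>G\<close>.\<close>

lemma (in abelian_pair) pullback_restriction:
  assumes "f \<in> hom G (G\<lparr>carrier := A\<rparr>)"
  shows "pullback G f (pullback (G\<lparr>carrier := A\<rparr>) (\<lambda>x. x) (h, c)) = pullback G f (h, c)"
proof -
  have "f x \<in> A" if "x \<in> carrier G" for x using assms that by (auto simp: hom_def)
  then show ?thesis by (auto simp: pullback_def fun_eq_iff restrict_def)
qed

lemma (in abelian_pair) quadratic_form_restriction:
  assumes A: "subgroup A G" and q: "q \<in> quadratic_forms G M"
  shows "restrict q A \<in> quadratic_forms (G\<lparr>carrier := A\<rparr>) M"
proof -
  interpret A: subgroup A G by (rule A)
  interpret quadratic_form G M q by unfold_locales (rule q)
  have "polarization (G\<lparr>carrier := A\<rparr>) M (restrict q A) x y = b x y" if "x \<in> A" "y \<in> A" for x y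
    using that by (simp add: polarization_def)
  then show ?thesis
    by (auto simp: quadratic_forms_def cochain_group1_def bilinear_map_def hom_def A
        b_mult_left b_mult_right)
qed

lemma (in abelian_pair) restriction_pair: "subgroup A G \<Longrightarrow> abelian_pair (G\<lparr>carrier := A\<rparr>) M"
  by (intro abelian_pair.intro subgroup_imp_comm_group G.comm_group_axioms M.comm_group_axioms)

text \<open>Injectivity of the trace. The quantifiers are inside the formula so that it can serve as
  the predicate of the induction.\<close>

lemma coboundary_if_traceless_finitely_generated:
  fixes G :: "('g, 'a) monoid_scheme" and M :: "('m, 'b) monoid_scheme"
  assumes "comm_group G" "finitely_generated_group G" and M: "comm_group M"
  shows "\<forall>h c. (h, c) \<in> two_abelian_cocycles3 G M \<longrightarrow> (\<forall>x\<in>carrier G. c (x, x) = \<one>\<^bsub>M\<^esub>)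
    \<longrightarrow> (h, c) \<in> two_abelian_coboundaries3 G M"
  using assms(1,2)
proof (induction rule: finitely_generated_abelian_induct)
  case (cyclic G a)
  interpret comm_group G by (rule cyclic)
  interpret M: comm_group M by (rule M)
  interpret cyclic_pair G M a by unfold_locales (use cyclic in auto)
  show ?case
    using coboundary_if_traceless[OF coboundary_if_traceless_cyclic] by blast
next
  case (sum G A D p r)
  interpret comm_group G by (rule sum)
  interpret M: comm_group M by (rule M)
  interpret abelian_pair G M by unfold_locales
  interpret split_pair G M p r
    by unfold_locales (use sum hom_into_subgroup in auto)
  have pull: "pullback G f (h, c) \<in> B"
    if E: "subgroup E G" and f: "f \<in> hom G (G\<lparr>carrier := E\<rparr>)" and hc: "(h, c) \<in> Z"
      and tr: "\<forall>x\<in>carrier G. c (x, x) = \<one>\<^bsub>M\<^esub>"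
      and IH: "\<forall>h c. (h, c) \<in> two_abelian_cocycles3 (G\<lparr>carrier := E\<rparr>) M \<longrightarrow>
        (\<forall>x\<in>carrier (G\<lparr>carrier := E\<rparr>). c (x, x) = \<one>\<^bsub>M\<^esub>) \<longrightarrow>
        (h, c) \<in> two_abelian_coboundaries3 (G\<lparr>carrier := E\<rparr>) M"
    for E f h c
  proof -
    obtain h' c' where hc': "pullback (G\<lparr>carrier := E\<rparr>) (\<lambda>x. x) (h, c) = (h', c')"
      by fastforce
    then have "\<forall>x\<in>carrier (G\<lparr>carrier := E\<rparr>). c' (x, x) = \<one>\<^sub>M"
      using tr subgroup.subset[OF E] by (auto simp: pullback_def)
    moreover have "(h', c') \<in> two_abelian_cocycles3 (G\<lparr>carrier := E\<rparr>) M"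
      unfolding hc'[symmetric]
      by (rule abelian_pair.pullback_cocycle[OF restriction_pair[OF E] comm_group_axioms hom_subgroup_incl[OF E] hc])
    ultimately have "pullback (G\<lparr>carrier := E\<rparr>) (\<lambda>x. x) (h, c) \<in> two_abelian_coboundaries3 (G\<lparr>carrier := E\<rparr>) M"
      using IH unfolding hc' by blast
    from pullback_coboundary[OF subgroup_imp_comm_group[OF comm_group_axioms E] f this]
    show ?thesis by (simp only: pullback_restriction[OF f])
  qed
  have "(h, c) \<in> B" if "traceless_cocycle G M h c" for h c
  proof -
    interpret T: traceless_cocycle G M h c by (rule that)
    have tr: "\<forall>x\<in>carrier G. c (x, x) = \<one>\<^sub>M" by (simp add: T.traceless)
    show ?thesis
      by (rule coboundary_if_coboundary_on_factors[OF that
            pull[OF sum(2,4) T.cocycle tr sum(7)] pull[OF sum(3,5) T.cocycle tr sum(8)]])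
  qed
  then show ?case using coboundary_if_traceless by blast
qed

lemma cocycle_of_quadratic_form_finitely_generated:
  fixes G :: "('g, 'a) monoid_scheme" and M :: "('m, 'b) monoid_scheme"
  assumes "comm_group G" "finitely_generated_group G" and M: "comm_group M"
  shows "\<forall>q\<in>quadratic_forms G M. \<exists>h c. (h, c) \<in> two_abelian_cocycles3 G M \<and> (\<forall>x\<in>carrier G. c (x, x) = q x)"
  using assms(1,2)
proof (induction rule: finitely_generated_abelian_induct)
  case (cyclic G a)
  interpret comm_group G by (rule cyclic)
  interpret M: comm_group M by (rule M)
  interpret cyclic_pair G M a by unfold_locales (use cyclic in auto)
  show ?case using cocycle_of_quadratic_form by blast
next
  case (sum G A D p r)
  interpret comm_group G by (rule sum)
  interpret M: comm_group M by (rule M)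
  interpret abelian_pair G M by unfold_locales
  interpret split_pair G M p r
    by unfold_locales (use sum hom_into_subgroup in auto)
  \<comment> \<open>Restrict \<open>q\<close> to the summand, realize it there by the induction
    hypothesis, and pull the cocycle back along the projection; its trace is then \<open>q\<close>
    composed with \<open>f\<close>.\<close>
  have lift: "\<exists>h c. (h, c) \<in> Z \<and> (\<forall>x\<in>carrier G. c (x, x) = q (f x))"
    if E: "subgroup E G" and f: "f \<in> hom G (G\<lparr>carrier := E\<rparr>)" and q: "q \<in> quadratic_forms G M"
      and IH: "\<forall>q\<in>quadratic_forms (G\<lparr>carrier := E\<rparr>) M. \<exists>h c.
        (h, c) \<in> two_abelian_cocycles3 (G\<lparr>carrier := E\<rparr>) M \<and> (\<forall>x\<in>carrier (G\<lparr>carrier := E\<rparr>). c (x, x) = q x)"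
    for E f q
  proof -
    obtain h c where hc: "(h, c) \<in> two_abelian_cocycles3 (G\<lparr>carrier := E\<rparr>) M" "\<forall>x\<in>E. c (x, x) = q x"
      using bspec[OF IH quadratic_form_restriction[OF E q]] by auto
    have "f x \<in> E" if "x \<in> carrier G" for x using f that by (auto simp: hom_def)
    with hc pullback_cocycle[OF subgroup_imp_comm_group[OF comm_group_axioms E] f hc(1)]
    show ?thesis by (intro exI conjI) (auto simp: pullback_def)
  qed
  show ?case
  proof
    fix q assume q: "q \<in> quadratic_forms G M"
    obtain h1 c1 where 1: "(h1, c1) \<in> Z" "\<forall>x\<in>carrier G. c1 (x, x) = q (p x)"
      using lift[OF sum(2,4) q sum(7)] by blast
    obtain h2 c2 where 2: "(h2, c2) \<in> Z" "\<forall>x\<in>carrier G. c2 (x, x) = q (r x)"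
      using lift[OF sum(3,5) q sum(8)] by blast
    show "\<exists>h c. (h, c) \<in> two_abelian_cocycles3 G M \<and> (\<forall>x\<in>carrier G. c (x, x) = q x)"
      using cocycle_of_quadratic_form_sum[OF q 1(1) _ 2(1)] 1(2) 2(2) by blast
  qed
qed

theorem theorem3p5:
  fixes G :: "('g, 'a) monoid_scheme" and M :: "('m, 'b) monoid_scheme"
  assumes "comm_group G" and "finitely_generated_group G" and "comm_group M"
  shows "trace_map G \<in> iso (two_abelian_cohomology3 G M) (Quad G M) \<and>
    (\<forall>(h, c) \<in> two_abelian_cocycles3 G M. \<forall>x\<in>carrier G.
      trace_map G (two_abelian_class3 G M (h, c)) x = c (x, x))"
proof -
  interpret abelian_pair G M by (intro abelian_pair.intro assms)
  interpret P: comm_group "two_abelian_cocycle_group3 G M"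
    by (rule comm_group_two_abelian_cocycle_group3[OF assms(1,3)])
  interpret Q: comm_group "Quad G M" by (rule comm_group_Quad[OF assms(1,3)])
  have carrier_P: "carrier (two_abelian_cocycle_group3 G M) = Z"
    by (simp add: two_abelian_cocycle_group3_def)
  have trace: "cocycle_trace G (h, c) \<in> quadratic_forms G M" if "(h, c) \<in> Z" for h c
  proof -
    interpret two_abelian_cocycle G M h c by unfold_locales (rule that)
    show ?thesis using trace_quadratic by (simp add: cocycle_trace_def)
  qed
  interpret tr: group_hom "two_abelian_cocycle_group3 G M" "Quad G M" "cocycle_trace G"
  proof (unfold_locales, rule homI)
    fix u assume "u \<in> carrier (two_abelian_cocycle_group3 G M)"
    then show "cocycle_trace G u \<in> carrier (Quad G M)"
      using trace by (cases u) (simp add: carrier_P Quad_def)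
  next
    fix u v
    show "cocycle_trace G (u \<otimes>\<^bsub>two_abelian_cocycle_group3 G M\<^esub> v)
      = cocycle_trace G u \<otimes>\<^bsub>Quad G M\<^esub> cocycle_trace G v"
      by (cases u; cases v)
         (auto simp: cocycle_trace_def two_abelian_cocycle_group3_def Quad_def cochain_group1_def
           cochain_group2_def cochain_group3_def)
  qed
  have "cocycle_trace G ` carrier (two_abelian_cocycle_group3 G M) = carrier (Quad G M)"
  proof
    show "carrier (Quad G M) \<subseteq> cocycle_trace G ` carrier (two_abelian_cocycle_group3 G M)"
    proof
      fix q assume "q \<in> carrier (Quad G M)"
      then have q: "q \<in> quadratic_forms G M" by (simp add: Quad_def)
      obtain h c where hc: "(h, c) \<in> Z" "\<forall>x\<in>carrier G. c (x, x) = q x"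
        using cocycle_of_quadratic_form_finitely_generated[OF assms] q by blast
      have "q \<in> extensional (carrier G)"
        using q by (auto simp: quadratic_forms_def cochain_group1_def PiE_iff)
      then have "q = cocycle_trace G (h, c)"
        using hc(2) by (auto simp: cocycle_trace_def intro!: extensionalityI)
      then show "q \<in> cocycle_trace G ` carrier (two_abelian_cocycle_group3 G M)"
        using hc(1) carrier_P by blast
    qed
  qed (use tr.hom_closed in blast)
  moreover have "kernel (two_abelian_cocycle_group3 G M) (Quad G M) (cocycle_trace G) = B"
  proof -
    have one: "cocycle_trace G (h, c) = \<one>\<^bsub>Quad G M\<^esub> \<longleftrightarrow> (\<forall>x\<in>carrier G. c (x, x) = \<one>\<^sub>M)" for h c
      by (auto simp: cocycle_trace_def Quad_def cochain_group1_def fun_eq_iff restrict_def)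
    have "c (x, x) = \<one>\<^sub>M" if "(h, c) \<in> B" "x \<in> carrier G" for h c x
      using that
      by (auto simp: two_abelian_coboundaries3_def cochain_group2_def commutator2_def PiE_iff intro!: M.r_inv)
    then show ?thesis
      using coboundary_if_traceless_finitely_generated[OF assms] coboundary_cocycle
      by (fastforce simp: kernel_def carrier_P one)
  qed
  \<comment> \<open>The first isomorphism theorem: the induced map sends a coset to the single
    element of its image, which is how \<open>trace_map\<close> is defined.\<close>
  ultimately have "trace_map G \<in> iso (two_abelian_cohomology3 G M) (Quad G M)"
    using tr.FactGroup_iso_set by (simp add: two_abelian_cohomology3_def trace_map_def[abs_def])
  then show ?thesis
    using trace_map_class[OF assms(1,3)] by auto
qed

end
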